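(* Let $n\geq1$, $\mu>0$, $k\in\mathbb{N}$ with $k\geq1$, $\varepsilon>0$, and let $p>1$ be arbitrary if $n=1$, and $1<p<p_{\mathrm{Gla}}(n)=\frac{n+1}{n-1}$ if $n\geq2$. Assume that $u_0\in W^{1,1}_{\mathrm{loc}}(\mathbb{R}^n)$ and $u_1\in L^1_{\mathrm{loc}}(\mathbb{R}^n)$ are nonnegative, nontrivial (i.e. neither is identically zero), compactly supported functions with $\operatorname{supp}(u_0,u_1)\subset B_R(0)$ for some $R>0$. Let $u$ be a weak solution on $[0,T_\varepsilon)$ of the Cauchy problem $$u_{tt}-\Delta u+b(t)u_t=|u_t|^p,\qquad u(0,x)=\varepsilon u_0(x),\quad u_t(0,x)=\varepsilon u_1(x).$$ Then $u$ blows up in finite time, and there exists $\varepsilon_0=\varepsilon_0(n,p,\mu,k,u_0,u_1,R)>0$ such that for any $\varepsilon\in(0,\varepsilon_0]$ the lifespan $T_\varepsilon$ of $u$ satisfies $$T_\varepsilon\left(\ln^{[k]}\left(\mathrm{e}^{[k]}+T_\varepsilon\right)\right)^{-\mu\left(\frac{1}{p-1}-\frac{n-1}{2}\right)^{-1}}\leq C\,\varepsilon^{-\left(\frac{1}{p-1}-\frac{n-1}{2}\right)^{-1}},$$ where $C$ is a positive constant independent of $\varepsilon$.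
   Context: Notation. $B_R(0)=\{x\in\mathbb{R}^n:|x|\le R\}$. Iterated logarithms and exponentials: $\ln^{[1]}(r)=\ln r$, $\ln^{[j]}(r)=\ln(\ln^{[j-1]}(r))$ for $j\ge2$; $\mathrm{e}^{[1]}=\mathrm{e}$, $\mathrm{e}^{[j]}=\mathrm{e}^{\mathrm{e}^{[j-1]}}$ for $j\ge2$. The damping coefficient is $$b(t)=\frac{\mu}{(\mathrm{e}^{[k]}+t)\prod_{j=1}^k\ln^{[j]}(\mathrm{e}^{[k]}+t)},\qquad t\ge0.$$ Weak solution. A weak solution on $[0,T)$ of $u_{tt}-\Delta u+b(t)u_t=f(u,u_t)$, $u(0,\cdot)=\varepsilon u_0$, $u_t(0,\cdot)=\varepsilon u_1$ (here $f(u,u_t)=|u_t|^p$), with data supported in $B_R(0)$, is a function $u\in\mathscr{C}([0,T),W^{1,1}_{\mathrm{loc}}(\mathbb{R}^n))\cap\mathscr{C}^1([0,T),L^1_{\mathrm{loc}}(\mathbb{R}^n))$ with $f(u,u_t)\in L^1_{\mathrm{loc}}([0,T)\times\mathbb{R}^n)$ such that: (1) $\operatorname{supp}u(t,\cdot)\subset B_{R+t}(0)$ for all $t\in(0,T)$; (2) $u(0,\cdot)=\varepsilon u_0$ in $L^1_{\mathrm{loc}}(\mathbb{R}^n)$; (3) for all $t\in(0,T)$ and all $\psi\in\mathscr{C}_0^\infty([0,T)\times\mathbb{R}^n)$, $$\int_0^t\int_{\mathbb{R}^n}\big(-u_t\psi_s+\nabla u\cdot\nabla\psi+b(s)u_t\psi\big)\,\mathrm{d}x\,\mathrm{d}s+\int_{\mathbb{R}^n}u_t(t,x)\psi(t,x)\,\mathrm{d}x=\varepsilon\int_{\mathbb{R}^n}u_1(x)\psi(0,x)\,\mathrm{d}x+\int_0^t\int_{\mathbb{R}^n}f(u,u_t)\psi\,\mathrm{d}x\,\mathrm{d}s,$$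 where in the double integrals the functions are evaluated at $(s,x)$. The lifespan $T_\varepsilon$ is the maximal existence time of the solution; "$u$ blows up in finite time" means that the lifespan is finite. *)

theory Defs
  imports "HOL-Analysis.Analysis"
begin

subsection \<open>Iterated logarithms and exponentials, the damping coefficient\<close>

definition iter_ln :: "nat \<Rightarrow> real \<Rightarrow> real" where
  "iter_ln j r = ((ln :: real \<Rightarrow> real) ^^ j) r"

definition iter_e :: "nat \<Rightarrow> real" where
  "iter_e j = ((exp :: real \<Rightarrow> real) ^^ j) 1"

definition damping :: "real \<Rightarrow> nat \<Rightarrow> real \<Rightarrow> real" where
  "damping \<mu> k t = \<mu> / ((iter_e k + t) * (\<Prod>j=1..k. iter_ln j (iter_e k + t)))"

definition p_Gla :: "nat \<Rightarrow> real" where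
  "p_Gla n = (real n + 1) / (real n - 1)"

subsection \<open>Test functions\<close>

primrec C_k :: "nat \<Rightarrow> ('a::euclidean_space \<Rightarrow> real) \<Rightarrow> bool" where
  "C_k 0 f \<longleftrightarrow> continuous_on UNIV f"
| "C_k (Suc m) f \<longleftrightarrow>
     (\<forall>x. f differentiable (at x)) \<and> (\<forall>v. C_k m (\<lambda>x. frechet_derivative f (at x) v))"

definition smooth :: "('a::euclidean_space \<Rightarrow> real) \<Rightarrow> bool" where
  "smooth f \<longleftrightarrow> (\<forall>m. C_k m f)"

definition test_function :: "'a::euclidean_space set \<Rightarrow> ('a \<Rightarrow> real) \<Rightarrow> bool" where
  "test_function \<Omega> \<phi> \<longleftrightarrow>
     smooth \<phi> \<and> compact (closure {x. \<phi> x \<noteq> 0}) \<and> closure {x. \<phi> x \<noteq> 0} \<subseteq> \<Omega>"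

definition grad :: "(real^'n \<Rightarrow> real) \<Rightarrow> real^'n \<Rightarrow> real^'n" where
  "grad \<phi> x = (\<chi> i. frechet_derivative \<phi> (at x) (axis i 1))"

subsection \<open>Local Lebesgue and Sobolev spaces\<close>

text \<open>Elements of these spaces are represented by Lebesgue measurable functions; all notions
  below are invariant under changes on null sets. In \<open>L1_loc \<Omega>\<close> the set \<open>\<Omega>\<close> need not be open:
  for \<open>\<Omega> = [0,T) \<times> \<real>^n\<close> the compact subsets may touch the initial time.\<close>

definition L1_loc :: "'a::euclidean_space set \<Rightarrow> ('a \<Rightarrow> 'b::euclidean_space) \<Rightarrow> bool" where
  "L1_loc \<Omega> f \<longleftrightarrow> (\<forall>K. compact K \<and> K \<subseteq> \<Omega> \<longrightarrow> f absolutely_integrable_on K)"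

definition ess_support :: "('a::euclidean_space \<Rightarrow> real) \<Rightarrow> 'a set" where
  "ess_support f = {x. \<forall>U. open U \<and> x \<in> U \<longrightarrow> \<not> (AE y in lebesgue. y \<in> U \<longrightarrow> f y = 0)}"

definition weak_gradient :: "(real^'n \<Rightarrow> real) \<Rightarrow> (real^'n \<Rightarrow> real^'n) \<Rightarrow> bool" where
  "weak_gradient f g \<longleftrightarrow> L1_loc UNIV f \<and> L1_loc UNIV g \<and>
     (\<forall>\<phi> i. test_function UNIV \<phi> \<longrightarrow>
        (LINT x|lebesgue. f x * grad \<phi> x $ i) = - (LINT x|lebesgue. g x $ i * \<phi> x))"

definition W11_loc :: "(real^'n \<Rightarrow> real) \<Rightarrow> bool" where
  "W11_loc f \<longleftrightarrow> (\<exists>g. weak_gradient f g)"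

subsection \<open>Curves with values in these spaces\<close>

definition time_interval :: "ereal \<Rightarrow> real set" where
  "time_interval T = {t. 0 \<le> t \<and> ereal t < T}"

definition continuous_L1_loc ::
    "ereal \<Rightarrow> (real \<Rightarrow> real^'n \<Rightarrow> 'b::euclidean_space) \<Rightarrow> bool" where
  "continuous_L1_loc T v \<longleftrightarrow> (\<forall>t\<in>time_interval T. L1_loc UNIV (v t) \<and>
     (\<forall>K. compact K \<longrightarrow>
        ((\<lambda>s. LINT x:K|lebesgue. norm (v s x - v t x)) \<longlongrightarrow> 0) (at t within time_interval T)))"

definition derivative_L1_loc ::
    "ereal \<Rightarrow> (real \<Rightarrow> real^'n \<Rightarrow> real) \<Rightarrow> (real \<Rightarrow> real^'n \<Rightarrow> real) \<Rightarrow> bool" where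
  "derivative_L1_loc T v w \<longleftrightarrow> (\<forall>t\<in>time_interval T. \<forall>K. compact K \<longrightarrow>
     ((\<lambda>s. LINT x:K|lebesgue. \<bar>(v s x - v t x) / (s - t) - w t x\<bar>) \<longlongrightarrow> 0)
       (at t within time_interval T))"

subsection \<open>Weak solutions and their lifespan\<close>

text \<open>\<open>weak_solution b p \<epsilon> u0 u1 R T u\<close>: the function \<open>u\<close> is a weak solution on \<open>[0,T)\<close>, with
  \<open>0 < T \<le> \<infinity>\<close>, of \<open>u_tt - \<Delta>u + b(t) u_t = |u_t|^p\<close> with data \<open>\<epsilon> u0\<close>, \<open>\<epsilon> u1\<close> supported in
  the closed ball of radius \<open>R\<close>. The curves \<open>ut\<close> and \<open>Du\<close> represent the time derivative and the
  weak spatial gradient; both are determined by \<open>u\<close> up to null sets at each time, and the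
  existential quantifier permits a representative of \<open>ut\<close> that is jointly measurable in time and
  space. Test functions in \<open>C_0^\<infinity>([0,T) \<times> \<real>^n)\<close>, which need not vanish at the initial time, are
  taken to be restrictions of smooth functions on the whole space-time whose support is compact
  and contained in \<open>(-\<infinity>,T) \<times> \<real>^n\<close>.\<close>

definition weak_solution ::
    "(real \<Rightarrow> real) \<Rightarrow> real \<Rightarrow> real \<Rightarrow> (real^'n \<Rightarrow> real) \<Rightarrow> (real^'n \<Rightarrow> real) \<Rightarrow> real
      \<Rightarrow> ereal \<Rightarrow> (real \<Rightarrow> real^'n \<Rightarrow> real) \<Rightarrow> bool" where
  "weak_solution b p \<epsilon> u0 u1 R T u \<longleftrightarrow> 0 < T \<and>
     (\<exists>ut Du.
        continuous_L1_loc T u \<and>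
        (\<forall>t\<in>time_interval T. weak_gradient (u t) (Du t)) \<and>
        continuous_L1_loc T Du \<and>
        derivative_L1_loc T u ut \<and>
        continuous_L1_loc T ut \<and>
        L1_loc (time_interval T \<times> UNIV) (\<lambda>(s, x). \<bar>ut s x\<bar> powr p) \<and>
        (\<forall>t>0. ereal t < T \<longrightarrow> ess_support (u t) \<subseteq> cball 0 (R + t)) \<and>
        (AE x in lebesgue. u 0 x = \<epsilon> * u0 x) \<and>
        (\<forall>t \<psi>. 0 < t \<and> ereal t < T \<and> test_function {(s, x). ereal s < T} (\<lambda>(s, x). \<psi> s x) \<longrightarrow>
           (LINT s:{0..t}|lebesgue. LINT x|lebesgue.
               - ut s x * deriv (\<lambda>r. \<psi> r x) s + Du s x \<bullet> grad (\<psi> s) x + b s * ut s x * \<psi> s x)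
             + (LINT x|lebesgue. ut t x * \<psi> t x)
           = \<epsilon> * (LINT x|lebesgue. u1 x * \<psi> 0 x)
             + (LINT s:{0..t}|lebesgue. LINT x|lebesgue. \<bar>ut s x\<bar> powr p * \<psi> s x)))"

text \<open>The maximal existence time of a weak solution \<open>u\<close> given on \<open>[0,T)\<close>: the supremum of all
  \<open>T' \<ge> T\<close> such that \<open>u\<close> extends to a weak solution on \<open>[0,T')\<close>.\<close>

definition lifespan ::
    "(real \<Rightarrow> real) \<Rightarrow> real \<Rightarrow> real \<Rightarrow> (real^'n \<Rightarrow> real) \<Rightarrow> (real^'n \<Rightarrow> real) \<Rightarrow> real
      \<Rightarrow> ereal \<Rightarrow> (real \<Rightarrow> real^'n \<Rightarrow> real) \<Rightarrow> ereal" where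
  "lifespan b p \<epsilon> u0 u1 R T u =
     Sup {T'. T \<le> T' \<and> (\<exists>v. weak_solution b p \<epsilon> u0 u1 R T' v \<and>
                (\<forall>t\<in>time_interval T. AE x in lebesgue. v t x = u t x))}"

end

(* Test the equation with a plane wave e^{x_1}, cut off outside the light cone, instead of the
  spherically averaged eigenfunction of the Laplacian: its mass on the ball of radius R + t is still
  O((R + t)^{(n-1)/2} e^{R+t}). With A(t) = \<integral> u_t e^{x_1}, B(t) = \<integral> u e^{x_1} and N(t) = \<integral> |u_t|^p e^{x_1}
  this gives B' = A and A' = B - b A + N, while Jensen's inequality gives
  N \<ge> \<kappa> e^{-(p-1)t} |A|^p. Let \<beta> = (ln^{[k]}(e^{[k]} + t))^\<mu>, so that \<beta>' = b \<beta>. The multipliers \<beta> e^{-t}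
  for A + B and \<beta> e^t for A show that \<beta> e^{-t} A dominates
  L = c \<epsilon> + (1/2) \<integral> \<beta> e^{-s} N, and L' \<ge> const \<cdot> L^p yields T^\<theta> \<le> C \<beta>(T) / \<epsilon> for T \<ge> 1. *)

theory Submission
  imports Defs "HOL-Probability.Distributions" "HOL-Real_Asymp.Real_Asymp"
begin

subsection \<open>A damped system of differential inequalities\<close>

text \<open>A need not be differentiable: local integrability of |u_t|^p makes N merely integrable
  in time, so the equation for A' is available only in integrated form, and the multipliers have to
  act on increments of continuous functions. The sign of B is not known in advance. It is
  nonnegative while A + B > 0, because (e^t B)' = e^t (A + B), and A + B stays positive while B is
  nonnegative; an argument at the first zero of A + B closes this loop. The final time T is fixed
  before the differential inequality for L is solved. The algebraic factor (R + s)^{(n-1)/2} of the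
  mass and the weight \<beta>(s)^{1-p} are replaced by their values at s = T, so that the inequality
  has constant coefficients. In the subcritical range the first replacement loses no power of T: for
  (n-1)(p-1)/2 < 1 the integral of (R + s)^{-(n-1)(p-1)/2} over [0,T] has the same order as T (R +
  T)^{-(n-1)(p-1)/2} for large T. The remaining power is 1 - (n-1)(p-1)/2 = (p-1) \<theta>, with
  \<theta> = 1/(p-1) - (n-1)/2.\<close>

lemma le_if_almost_increasing:
  fixes \<phi> :: "real \<Rightarrow> real"
  assumes "a \<le> b"
    and step: "\<And>e. e > 0 \<Longrightarrow> \<exists>d>0. \<forall>s t. a \<le> s \<and> s \<le> t \<and> t \<le> b \<and> t - s < d \<longrightarrow>
          \<phi> t - \<phi> s \<ge> - e * (t - s)"
  shows "\<phi> a \<le> \<phi> b"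
proof -
  have "\<phi> b - \<phi> a \<ge> - e * (b - a)" if e: "e > 0" for e
  proof -
    obtain d where d: "d > 0" "\<And>s t. a \<le> s \<Longrightarrow> s \<le> t \<Longrightarrow> t \<le> b \<Longrightarrow> t - s < d \<Longrightarrow>
          \<phi> t - \<phi> s \<ge> - e * (t - s)"
      using step[OF e] by blast
    \<comment> \<open>With N equal steps, each shorter than d, the increments telescope and the
      total loss is e * (b - a), which vanishes with e. This replaces the criterion of a nonnegative
      derivative, since \<phi> need not be differentiable.\<close>
    obtain N :: nat where N: "N > 0" "(b - a) / d < real N"
      by (metis reals_Archimedean2 gr0I of_nat_0_less_iff of_nat_0 assms(1) d(1) diff_ge_0_iff_ge
          divide_nonneg_pos less_le_not_le)
    define h where "h = (b - a) / real N"
    have h: "h \<ge> 0" "h < d" "real N * h = b - a"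
      using N d(1) assms(1) by (auto simp: h_def field_simps)
    have "\<phi> (a + real j * h) - \<phi> a \<ge> - e * (real j * h)" if "j \<le> N" for j
      using that
    proof (induction j)
      case (Suc j)
      have "real (Suc j) * h \<le> real N * h"
        using Suc.prems h by (intro mult_right_mono) auto
      then have "\<phi> (a + real (Suc j) * h) - \<phi> (a + real j * h) \<ge> - e * h"
        using d(2)[of "a + real j * h" "a + real (Suc j) * h"] h by (simp add: algebra_simps)
      then show ?case
        using Suc by (simp add: algebra_simps)
    qed auto
    from this[of N] h show ?thesis
      by simp
  qed
  then have le: "\<phi> a \<le> \<phi> b + e * (b - a)" if "e > 0" for e
    using that by force
  show ?thesis
  proof (rule field_le_epsilon)
    fix e :: real assume e: "e > 0"
    have "e / (b - a + 1) * (b - a) \<le> e"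
      using e assms(1) by (simp add: field_simps)
    then show "\<phi> a \<le> \<phi> b + e"
      using le[of "e / (b - a + 1)"] e assms(1) by simp
  qed
qed

text \<open>The nonlinearity is only integrable in time, so the inequality \<open>Y' \<ge> r\<close> is available only in
  integrated form; for continuous \<open>Y\<close> it still obeys a one-sided product rule.\<close>

definition integrated_deriv_ge :: "real \<Rightarrow> (real \<Rightarrow> real) \<Rightarrow> (real \<Rightarrow> real) \<Rightarrow> bool" where
  "integrated_deriv_ge T Y r \<longleftrightarrow> continuous_on {0..T} Y \<and> continuous_on {0..T} r \<and>
     (\<forall>s t. 0 \<le> s \<and> s \<le> t \<and> t \<le> T \<longrightarrow> integral {s..t} r \<le> Y t - Y s)"

lemma integrated_deriv_geD:
  "integrated_deriv_ge T Y r \<Longrightarrow> 0 \<le> s \<Longrightarrow> s \<le> t \<Longrightarrow> t \<le> T \<Longrightarrow> integral {s..t} r \<le> Y t - Y s"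
  by (simp add: integrated_deriv_ge_def)

lemma integral_deriv_eq:
  fixes F f :: "real \<Rightarrow> real"
  assumes "\<And>t. t \<in> {0..T} \<Longrightarrow> (F has_real_derivative f t) (at t within {0..T})"
    and "0 \<le> s" "s \<le> t" "t \<le> T"
  shows "integral {s..t} f = F t - F s"
proof (rule integral_unique, rule fundamental_theorem_of_calculus)
  fix x assume x: "x \<in> {s..t}"
  show "(F has_vector_derivative f x) (at x within {s..t})"
    by (rule has_vector_derivative_within_subset[of _ _ _ "{0..T}"])
      (use assms x in \<open>auto simp: has_real_derivative_iff_has_vector_derivative\<close>)
qed fact

text \<open>Over a short interval the increment of m * Y splits into m s * (Y t - Y s) and (m t - m
  s) * Y t. Nonnegativity of m allows the inequality for Y to be multiplied, and m t - m s is the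
  integral of m'. Freezing m at s and Y at t costs arbitrarily little per unit of time by uniform
  continuity, so m * Y minus the integral of the claimed lower bound is almost increasing.\<close>

lemma integrated_deriv_ge_mult:
  assumes Y: "integrated_deriv_ge T Y r"
    and m: "\<And>t. t \<in> {0..T} \<Longrightarrow> (m has_real_derivative m' t) (at t within {0..T})"
    and m': "continuous_on {0..T} m'" and pos: "\<And>t. t \<in> {0..T} \<Longrightarrow> 0 \<le> m t"
  shows "integrated_deriv_ge T (\<lambda>t. m t * Y t) (\<lambda>t. m t * r t + m' t * Y t)"
proof -
  have cY: "continuous_on {0..T} Y" and cr: "continuous_on {0..T} r"
    and le: "\<And>s t. 0 \<le> s \<Longrightarrow> s \<le> t \<Longrightarrow> t \<le> T \<Longrightarrow> integral {s..t} r \<le> Y t - Y s"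
    using Y by (auto simp: integrated_deriv_ge_def)
  have cm: "continuous_on {0..T} m"
    using m by (rule DERIV_continuous_on)
  let ?q = "\<lambda>t. m t * r t + m' t * Y t"
  have cq: "continuous_on {0..T} ?q"
    by (intro continuous_intros cY cr cm m')
  have int: "f integrable_on {s..t}" if "continuous_on {0..T} f" "0 \<le> s" "t \<le> T"
    for f :: "real \<Rightarrow> real" and s t
    using that by (intro integrable_continuous_real) (auto intro: continuous_on_subset)
  have main: "integral {a..b} ?q \<le> m b * Y b - m a * Y a" if ab: "0 \<le> a" "a \<le> b" "b \<le> T" for a b
  proof -
    define \<phi> where "\<phi> = (\<lambda>t. m t * Y t - integral {a..t} ?q)"
    have "\<phi> a \<le> \<phi> b"
    proof (rule le_if_almost_increasing[OF ab(2)])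
      fix e :: real assume e: "e > 0"
      have "bounded (r ` {0..T})" "bounded (m' ` {0..T})"
        by (simp_all add: compact_imp_bounded compact_continuous_image cr m')
      then obtain M1 M2 where M1: "\<And>x. x \<in> {0..T} \<Longrightarrow> \<bar>r x\<bar> \<le> M1"
        and M2: "\<And>x. x \<in> {0..T} \<Longrightarrow> \<bar>m' x\<bar> \<le> M2"
        unfolding bounded_iff by (metis imageI real_norm_def)
      define M where "M = \<bar>M1\<bar> + \<bar>M2\<bar> + 1"
      have M: "M > 0" "\<And>x. x \<in> {0..T} \<Longrightarrow> \<bar>r x\<bar> \<le> M" "\<And>x. x \<in> {0..T} \<Longrightarrow> \<bar>m' x\<bar> \<le> M"
        using M1 M2 by (force simp: M_def)+
      have "uniformly_continuous_on {0..T} m" "uniformly_continuous_on {0..T} Y"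
        by (auto intro: compact_uniformly_continuous cm cY)
      \<comment> \<open>Multiplied by the common bound M for r and m', this tolerance lets each of
        the two freezing errors contribute at most e / 2.\<close>
      moreover have e2: "e / (2 * M) > 0"
        using e M by simp
      ultimately obtain d1 d2 where d1: "d1 > 0"
          "\<And>x y. x \<in> {0..T} \<Longrightarrow> y \<in> {0..T} \<Longrightarrow> dist y x < d1 \<Longrightarrow> dist (m y) (m x) < e / (2 * M)"
        and d2: "d2 > 0"
          "\<And>x y. x \<in> {0..T} \<Longrightarrow> y \<in> {0..T} \<Longrightarrow> dist y x < d2 \<Longrightarrow> dist (Y y) (Y x) < e / (2 * M)"
        unfolding uniformly_continuous_on_def by metis
      have "\<phi> t - \<phi> s \<ge> - e * (t - s)" if st: "a \<le> s" "s \<le> t" "t \<le> b" "t - s < min d1 d2" for s t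
      proof -
        have ran: "0 \<le> s" "t \<le> T"
          using st ab by auto
        have "integral {a..s} ?q + integral {s..t} ?q = integral {a..t} ?q"
          by (rule Henstock_Kurzweil_Integration.integral_combine) (use st ab in \<open>auto intro!: int cq\<close>)
        then have "\<phi> t - \<phi> s = m t * Y t - m s * Y s - integral {s..t} ?q"
          by (simp add: \<phi>_def)
        also have "\<dots> = m s * (Y t - Y s) + (m t - m s) * Y t - integral {s..t} ?q"
          by (simp add: algebra_simps)
        also have "\<dots> \<ge> m s * integral {s..t} r + integral {s..t} m' * Y t - integral {s..t} ?q"
          using le[of s t] pos[of s] integral_deriv_eq[OF m, of s t] ran st
          by (auto intro!: mult_left_mono)
        also have "m s * integral {s..t} r + integral {s..t} m' * Y t - integral {s..t} ?q =
            integral {s..t} (\<lambda>x. m s * r x + m' x * Y t - ?q x)"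
          using ran by (subst integral_diff, auto intro!: int continuous_intros cr m' cq)
            (subst integral_add, auto intro!: int continuous_intros cr m' cq)
        also have "\<dots> \<ge> integral {s..t} (\<lambda>x. - e)"
        proof (rule integral_le)
          fix x assume x: "x \<in> {s..t}"
          have "\<bar>(m s - m x) * r x\<bar> \<le> e / (2 * M) * M"
            unfolding abs_mult using d1(2)[of x s] x st ran M(1) M(2)[of x] e
            by (intro mult_mono) (auto simp: dist_real_def)
          moreover have "\<bar>m' x * (Y t - Y x)\<bar> \<le> M * (e / (2 * M))"
            unfolding abs_mult using d2(2)[of x t] x st ran M(1) M(3)[of x] e
            by (intro mult_mono) (auto simp: dist_real_def)
          moreover have "m s * r x + m' x * Y t - ?q x = (m s - m x) * r x + m' x * (Y t - Y x)"
            by (simp add: algebra_simps)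
          ultimately show "- e \<le> m s * r x + m' x * Y t - ?q x"
            using M(1) by (simp add: abs_le_iff)
        qed (use ran in \<open>auto intro!: int continuous_intros cr m' cq\<close>)
        also have "integral {s..t} (\<lambda>x. - e) = - e * (t - s)"
          using st by simp
        finally show ?thesis
          by simp
      qed
      then show "\<exists>d>0. \<forall>s t. a \<le> s \<and> s \<le> t \<and> t \<le> b \<and> t - s < d \<longrightarrow> \<phi> t - \<phi> s \<ge> - e * (t - s)"
        using d1(1) d2(1) by (intro exI[of _ "min d1 d2"]) auto
    qed
    then show ?thesis
      by (simp add: \<phi>_def)
  qed
  show ?thesis
    unfolding integrated_deriv_ge_def using main by (auto intro!: continuous_intros cY cr cm m')
qed

text \<open>With m = \<beta> e^{-t} and H = A + B, the terms containing A cancel and (m H)' is at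
  least m g + m b B. This is useful only for B \<ge> 0, which in turn rests on H > 0, so both signs
  are obtained together. The condition 2 c \<le> A 0 + B 0 starts the bound for m H, and c \<le> A 0
  starts the bound for A that is derived from it.\<close>

lemma damped_system_lower_bound:
  assumes T: "0 \<le> T"
    and B: "\<And>t. t \<in> {0..T} \<Longrightarrow> (B has_real_derivative A t) (at t within {0..T})"
    and A: "integrated_deriv_ge T A (\<lambda>t. B t - b t * A t + g t)"
    and b: "continuous_on {0..T} b" "\<And>t. t \<in> {0..T} \<Longrightarrow> 0 \<le> b t"
    and \<beta>: "\<And>t. t \<in> {0..T} \<Longrightarrow> (\<beta> has_real_derivative b t * \<beta> t) (at t within {0..T})"
    and \<beta>0: "\<beta> 0 = 1" "\<And>t. t \<in> {0..T} \<Longrightarrow> 0 < \<beta> t"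
    and g: "continuous_on {0..T} g" "\<And>t. t \<in> {0..T} \<Longrightarrow> 0 \<le> g t"
    and init: "0 < c" "c \<le> A 0" "2 * c \<le> A 0 + B 0" "0 \<le> B 0"
    and t: "t \<in> {0..T}"
  shows "\<beta> t * exp (- t) * A t \<ge> c + integral {0..t} (\<lambda>s. \<beta> s * exp (- s) * g s) / 2"
proof -
  define m where "m = (\<lambda>t. \<beta> t * exp (- t))"
  define H where "H = (\<lambda>t. A t + B t)"
  define Q where "Q = (\<lambda>t. integral {0..t} (\<lambda>s. m s * g s))"
  have cA: "continuous_on {0..T} A"
    using A by (simp add: integrated_deriv_ge_def)
  have cB: "continuous_on {0..T} B"
    by (rule DERIV_continuous_on[OF B])
  have c\<beta>: "continuous_on {0..T} \<beta>"
    by (rule DERIV_continuous_on[OF \<beta>])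
  have cm: "continuous_on {0..T} m"
    unfolding m_def by (intro continuous_intros c\<beta>)
  have cH: "continuous_on {0..T} H"
    unfolding H_def by (intro continuous_intros cA cB)
  note cont = cA cB c\<beta> cm cH b(1) g(1)
  have int: "f integrable_on {s..t}" if "continuous_on {0..T} f" "0 \<le> s" "t \<le> T"
    for f :: "real \<Rightarrow> real" and s t
    using that by (intro integrable_continuous_real) (auto intro: continuous_on_subset)
  have m_pos: "m t > 0" if "t \<in> {0..T}" for t
    using \<beta>0(2)[OF that] by (simp add: m_def)
  have dm: "(m has_real_derivative (b t - 1) * m t) (at t within {0..T})" if "t \<in> {0..T}" for t
    unfolding m_def by (rule derivative_eq_intros \<beta>[OF that] refl)+ (simp add: algebra_simps)
  have "integrated_deriv_ge T H (\<lambda>t. A t + (B t - b t * A t + g t))"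
    unfolding integrated_deriv_ge_def
  proof (intro conjI allI impI)
    fix s t assume st: "0 \<le> s \<and> s \<le> t \<and> t \<le> T"
    have "integral {s..t} (\<lambda>t. A t + (B t - b t * A t + g t)) =
        integral {s..t} A + integral {s..t} (\<lambda>t. B t - b t * A t + g t)"
      using st by (intro integral_add int continuous_intros cont) auto
    also have "\<dots> \<le> (B t - B s) + (A t - A s)"
      using A integral_deriv_eq[OF B, of s t] st by (auto simp: integrated_deriv_ge_def)
    finally show "integral {s..t} (\<lambda>t. A t + (B t - b t * A t + g t)) \<le> H t - H s"
      by (simp add: H_def)
  qed (auto intro!: continuous_intros cont)
  then have "integrated_deriv_ge T (\<lambda>t. m t * H t)
      (\<lambda>t. m t * (A t + (B t - b t * A t + g t)) + (b t - 1) * m t * H t)"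
    by (rule integrated_deriv_ge_mult[OF _ dm])
      (auto intro!: continuous_intros cont simp: m_pos less_imp_le)
  moreover have "(\<lambda>t. m t * (A t + (B t - b t * A t + g t)) + (b t - 1) * m t * H t) =
      (\<lambda>t. m t * g t + m t * b t * B t)"
    by (auto simp: H_def algebra_simps)
  ultimately have "integrated_deriv_ge T (\<lambda>t. m t * H t) (\<lambda>t. m t * g t + m t * b t * B t)"
    by simp
  from integrated_deriv_geD[OF this, of 0]
  have mH: "integral {0..t} (\<lambda>t. m t * g t + m t * b t * B t) \<le> m t * H t - H 0"
    if "t \<in> {0..T}" for t
    using that \<beta>0(1) by (simp add: m_def)
  \<comment> \<open>The derivative of exp t * B t is exp t * H t, so B inherits its sign from B 0
    and from H on the open interval before t.\<close>
  have B_nonneg: "B t \<ge> 0" if t: "t \<in> {0..T}" and pos: "\<And>s. 0 < s \<Longrightarrow> s < t \<Longrightarrow> H s > 0" for t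
  proof (cases "t = 0")
    case False
    have "exp 0 * B 0 \<le> exp t * B t"
    proof (rule DERIV_nonneg_imp_increasing_open[where f="\<lambda>t. exp t * B t"])
      show "0 \<le> t"
        using t by simp
      show "continuous_on {0..t} (\<lambda>t. exp t * B t)"
        using t by (intro continuous_intros continuous_on_subset[OF cB]) auto
      fix x assume x: "0 < x" "x < t"
      have "(B has_real_derivative A x) (at x)"
        using B[of x] x t by (simp add: at_within_Icc_at)
      then have "((\<lambda>t. exp t * B t) has_real_derivative exp x * H x) (at x)"
        by (auto intro!: derivative_eq_intros simp: H_def algebra_simps)
      then show "\<exists>y. ((\<lambda>t. exp t * B t) has_real_derivative y) (at x) \<and> 0 \<le> y"
        using pos[OF x] by (auto intro!: exI[of _ "exp x * H x"])
    qed
    then show ?thesis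
      using init(4) by (smt (verit) exp_gt_zero exp_zero mult_nonneg_nonneg zero_le_mult_iff)
  qed (use init in simp)
  have H0: "H 0 \<ge> 2 * c"
    using init by (simp add: H_def)
  have mH_ge: "2 * c + Q t \<le> m t * H t"
    if t: "t \<in> {0..T}" and pos: "\<And>s. 0 < s \<Longrightarrow> s < t \<Longrightarrow> H s > 0" for t
  proof -
    have "B s \<ge> 0" if "s \<in> {0..t}" for s
      using that t pos by (intro B_nonneg) auto
    then have "Q t \<le> integral {0..t} (\<lambda>t. m t * g t + m t * b t * B t)"
      unfolding Q_def using t m_pos b(2)
      by (intro integral_le int continuous_intros cont) (auto simp: less_imp_le)
    with mH[OF t] H0 show ?thesis
      by simp
  qed
  have Q_nonneg: "Q t \<ge> 0" if "t \<in> {0..T}" for t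
    unfolding Q_def using that g(2) m_pos
    by (intro integral_nonneg int continuous_intros cont) (auto simp: less_imp_le)
  have H_pos: "H t > 0" if t: "t \<in> {0..T}" for t
  proof (rule ccontr)
    assume "\<not> H t > 0"
    \<comment> \<open>\<open>Inf Z\<close> is the earliest time at which H is not positive.
      \<open>mH_ge\<close> asks for positivity only strictly before the time in question, so it
      applies at \<open>Inf Z\<close> itself and gives m H \<ge> 2 c > 0 there.\<close>
    define Z where "Z = {0..T} \<inter> H -` {..0}"
    have "t \<in> Z"
      using t \<open>\<not> H t > 0\<close> by (simp add: Z_def)
    moreover have "closed Z"
      unfolding Z_def by (intro continuous_closed_preimage cH) auto
    moreover have "bdd_below Z"
      by (auto simp: Z_def bdd_below_def)
    ultimately have Inf: "Inf Z \<in> Z"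
      by (intro closed_contains_Inf) auto
    have "H s > 0" if "0 < s" "s < Inf Z" for s
      using that Inf cInf_lower[OF _ \<open>bdd_below Z\<close>, of s] by (force simp: Z_def)
    then have "2 * c + Q (Inf Z) \<le> m (Inf Z) * H (Inf Z)"
      using Inf by (intro mH_ge) (auto simp: Z_def)
    moreover have "m (Inf Z) * H (Inf Z) \<le> 0"
      using Inf m_pos[of "Inf Z"] by (auto simp: Z_def mult_le_0_iff)
    ultimately show False
      using init(1) Q_nonneg[of "Inf Z"] Inf by (auto simp: Z_def)
  qed
  have dQ: "(Q has_real_derivative m t * g t) (at t within {0..T})" if "t \<in> {0..T}" for t
    unfolding Q_def has_real_derivative_iff_has_vector_derivative
    by (rule integral_has_vector_derivative[OF _ that]) (intro continuous_intros cont)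
  have cQ: "continuous_on {0..T} Q"
    by (rule DERIV_continuous_on[OF dQ])
  \<comment> \<open>This is \<beta> e^t. Its logarithmic derivative 1 + b cancels the damping of A
    and completes B to H.\<close>
  define m2 where "m2 = (\<lambda>t. exp (2 * t) * m t)"
  have dm2: "(m2 has_real_derivative (1 + b t) * m2 t) (at t within {0..T})" if "t \<in> {0..T}" for t
    unfolding m2_def by (rule derivative_eq_intros dm[OF that] refl)+ (simp add: algebra_simps)
  have cm2: "continuous_on {0..T} m2"
    unfolding m2_def by (intro continuous_intros cm)
  have "integrated_deriv_ge T (\<lambda>t. m2 t * A t)
      (\<lambda>t. m2 t * (B t - b t * A t + g t) + (1 + b t) * m2 t * A t)"
    by (rule integrated_deriv_ge_mult[OF A dm2])
      (auto intro!: continuous_intros cont cm2 simp: m_pos less_imp_le m2_def)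
  moreover have "(\<lambda>t. m2 t * (B t - b t * A t + g t) + (1 + b t) * m2 t * A t) =
      (\<lambda>t. exp (2 * t) * (m t * H t + m t * g t))"
    by (auto simp: H_def m2_def algebra_simps)
  ultimately have "integrated_deriv_ge T (\<lambda>t. m2 t * A t)
      (\<lambda>t. exp (2 * t) * (m t * H t + m t * g t))"
    by simp
  from integrated_deriv_geD[OF this, of 0 t]
  have "integral {0..t} (\<lambda>t. exp (2 * t) * (m t * H t + m t * g t)) \<le>
      m2 t * A t - A 0"
    using t \<beta>0(1) by (simp add: m2_def m_def)
  \<comment> \<open>Half of m g is given away so that the smaller integrand becomes the exact
    derivative of e^{2t} (c + Q/2). This is the origin of the factor 1/2 in the conclusion.\<close>
  moreover have "integral {0..t} (\<lambda>t. exp (2 * t) * (2 * c + Q t + m t * g t / 2)) \<le>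
      integral {0..t} (\<lambda>t. exp (2 * t) * (m t * H t + m t * g t))"
  proof (rule integral_le)
    fix s assume s: "s \<in> {0..t}"
    have "2 * c + Q s \<le> m s * H s"
      using s t by (intro mH_ge H_pos) auto
    moreover have "0 \<le> m s * g s"
      using g(2)[of s] m_pos[of s] s t by simp
    ultimately show "exp (2 * s) * (2 * c + Q s + m s * g s / 2) \<le>
        exp (2 * s) * (m s * H s + m s * g s)"
      by simp
  qed (use t in \<open>auto intro!: int continuous_intros cont cQ\<close>)
  moreover have "integral {0..t} (\<lambda>t. exp (2 * t) * (2 * c + Q t + m t * g t / 2)) =
      exp (2 * t) * (c + Q t / 2) - exp (2 * 0) * (c + Q 0 / 2)"
  proof (rule integral_deriv_eq[where T=T])
    fix s assume s: "s \<in> {0..T}"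
    show "((\<lambda>t. exp (2 * t) * (c + Q t / 2)) has_real_derivative
        exp (2 * s) * (2 * c + Q s + m s * g s / 2)) (at s within {0..T})"
      by (auto intro!: derivative_eq_intros dQ[OF s] simp: algebra_simps)
  qed (use t in auto)
  moreover have "Q 0 = 0"
    by (simp add: Q_def)
  ultimately have "exp (2 * t) * (c + Q t / 2) - c \<le> m2 t * A t - A 0"
    by simp
  then have "exp (2 * t) * (c + Q t / 2) \<le> exp (2 * t) * (m t * A t)"
    using init(2) unfolding m2_def mult.assoc by linarith
  then have "c + Q t / 2 \<le> m t * A t"
    by simp
  then show ?thesis
    by (simp add: Q_def m_def)
qed

text \<open>Because e^{-t} e^{-(p-1)t} = (e^{-t})^p, the decay of the nonlinearity is exactly the
  one that turns \<beta> e^{-t} g into \<kappa> \<beta>^{1-p} (\<beta> e^{-t} A)^p. Since p > 1, the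
  factor \<beta>^{1-p} is smallest at T, which leaves L' \<ge> a L^p with a constant a.\<close>

lemma damped_system_blowup:
  fixes p :: real
  assumes p: "p > 1" and T: "0 \<le> T"
    and B: "\<And>t. t \<in> {0..T} \<Longrightarrow> (B has_real_derivative A t) (at t within {0..T})"
    and A: "integrated_deriv_ge T A (\<lambda>t. B t - b t * A t + \<kappa> * exp (- (p - 1) * t) * \<bar>A t\<bar> powr p)"
    and b: "continuous_on {0..T} b" "\<And>t. t \<in> {0..T} \<Longrightarrow> 0 \<le> b t"
    and \<beta>: "\<And>t. t \<in> {0..T} \<Longrightarrow> (\<beta> has_real_derivative b t * \<beta> t) (at t within {0..T})"
    and \<beta>0: "\<beta> 0 = 1" "\<And>t. t \<in> {0..T} \<Longrightarrow> 0 < \<beta> t" "\<And>t. t \<in> {0..T} \<Longrightarrow> \<beta> t \<le> \<beta> T"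
    and \<kappa>: "\<kappa> \<ge> 0"
    and init: "0 < c" "c \<le> A 0" "2 * c \<le> A 0 + B 0" "0 \<le> B 0"
  shows "(p - 1) / 2 * \<kappa> * T * \<beta> T powr (1 - p) \<le> c powr (1 - p)"
proof -
  define g where "g = (\<lambda>t. \<kappa> * exp (- (p - 1) * t) * \<bar>A t\<bar> powr p)"
  define L where "L = (\<lambda>t. c + integral {0..t} (\<lambda>s. \<beta> s * exp (- s) * g s) / 2)"
  have cA: "continuous_on {0..T} A"
    using A by (simp add: integrated_deriv_ge_def)
  have c\<beta>: "continuous_on {0..T} \<beta>"
    by (rule DERIV_continuous_on[OF \<beta>])
  have cg: "continuous_on {0..T} g"
    unfolding g_def using p by (intro continuous_intros cA continuous_on_powr') auto
  have g: "g t \<ge> 0" for t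
    using \<kappa> by (simp add: g_def)
  have A': "integrated_deriv_ge T A (\<lambda>t. B t - b t * A t + g t)"
    using A by (simp add: g_def)
  have ge: "L t \<le> \<beta> t * exp (- t) * A t" if "t \<in> {0..T}" for t
    unfolding L_def
    by (rule damped_system_lower_bound[OF T B A' b \<beta> \<beta>0(1,2) cg g init that])
  have L: "L t \<ge> c" if "t \<in> {0..T}" for t
    unfolding L_def using that g \<beta>0(2)
    by (auto intro!: integral_nonneg integrable_continuous_real continuous_intros
        continuous_on_subset[OF cg] continuous_on_subset[OF c\<beta>] simp: less_imp_le)
  have dL: "(L has_real_derivative \<beta> t * exp (- t) * g t / 2) (at t within {0..T})"
    if "t \<in> {0..T}" for t
  proof -
    have "((\<lambda>t. integral {0..t} (\<lambda>s. \<beta> s * exp (- s) * g s)) has_real_derivative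
        \<beta> t * exp (- t) * g t) (at t within {0..T})"
      unfolding has_real_derivative_iff_has_vector_derivative
      by (rule integral_has_vector_derivative[OF _ that]) (intro continuous_intros c\<beta> cg)
    then show ?thesis
      unfolding L_def by (auto intro!: derivative_eq_intros)
  qed
  let ?a = "\<kappa> / 2 * \<beta> T powr (1 - p)"
  have ineq: "?a * L t powr p \<le> \<beta> t * exp (- t) * g t / 2" if t: "t \<in> {0..T}" for t
  proof -
    define X where "X = \<beta> t * exp (- t)"
    have X: "X > 0"
      using \<beta>0(2)[OF t] by (simp add: X_def)
    have At: "A t > 0"
    proof -
      have "0 < X * A t"
        using ge[OF t] L[OF t] init(1) unfolding X_def by simp
      then show ?thesis
        using X by (simp add: zero_less_mult_iff)
    qed
    have "L t powr p \<le> (X * A t) powr p"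
      using ge[OF t] L[OF t] init(1) p by (intro powr_mono2) (auto simp: X_def)
    then have "?a * L t powr p \<le> \<kappa> / 2 * \<beta> t powr (1 - p) * (X * A t) powr p"
      using \<kappa> \<beta>0(2)[OF t] \<beta>0(3)[OF t] p
      by (intro mult_mono powr_mono2'[of "1 - p"] mult_nonneg_nonneg order_refl) auto
    also have "\<dots> = \<kappa> / 2 * (\<beta> t powr (1 - p) * \<beta> t powr p) * (exp (- t) powr p) * A t powr p"
      using At \<beta>0(2)[OF t] by (simp add: X_def powr_mult)
    also have "\<beta> t powr (1 - p) * \<beta> t powr p = \<beta> t"
      using \<beta>0(2)[OF t] by (simp flip: powr_add)
    also have "exp (- t) powr p = exp (- t) * exp (- (p - 1) * t)"
      by (simp add: powr_def algebra_simps flip: exp_add)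
    finally show ?thesis
      using At by (simp add: g_def mult_ac)
  qed
  \<comment> \<open>Separation of variables: (L^{1-p})' \<le> - (p - 1) a makes \<psi>
    nonincreasing. At the end only \<open>L T powr (1 - p) \<ge> 0\<close> is used.\<close>
  define \<psi> where "\<psi> = (\<lambda>t. L t powr (1 - p) + (p - 1) * ?a * t)"
  have "\<psi> T \<le> \<psi> 0"
  proof (rule DERIV_nonpos_imp_decreasing_open[OF T])
    have "continuous_on {0..T} L"
      by (rule DERIV_continuous_on[OF dL])
    moreover have "L t \<noteq> 0" if "t \<in> {0..T}" for t
      using L[OF that] init(1) by simp
    ultimately show "continuous_on {0..T} \<psi>"
      unfolding \<psi>_def by (intro continuous_intros) auto
  next
    fix x assume x: "0 < x" "x < T"
    then have x': "x \<in> {0..T}"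
      by simp
    have dx: "(L has_real_derivative \<beta> x * exp (- x) * g x / 2) (at x)"
      using dL[OF x'] x by (simp add: at_within_Icc_at)
    have Lx: "L x > 0"
      using L[OF x'] init(1) by simp
    have "(\<psi> has_real_derivative (1 - p) * L x powr (- p) * (\<beta> x * exp (- x) * g x / 2) + (p - 1) * ?a)
        (at x)"
      unfolding \<psi>_def
    proof (rule DERIV_add[OF _ DERIV_cmult_Id])
      show "((\<lambda>t. L t powr (1 - p)) has_real_derivative
          (1 - p) * L x powr (- p) * (\<beta> x * exp (- x) * g x / 2)) (at x)"
        using DERIV_fun_powr[OF dx Lx, of "1 - p"] by simp
    qed
    moreover have "L x powr (- p) * (?a * L x powr p) \<le> L x powr (- p) * (\<beta> x * exp (- x) * g x / 2)"
      by (intro mult_left_mono ineq x') auto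
    then have "?a \<le> L x powr (- p) * (\<beta> x * exp (- x) * g x / 2)"
      using Lx by (simp add: powr_minus field_simps)
    then have "(p - 1) * (?a - L x powr (- p) * (\<beta> x * exp (- x) * g x / 2)) \<le> 0"
      using p by (intro mult_nonneg_nonpos) auto
    then have "(1 - p) * L x powr (- p) * (\<beta> x * exp (- x) * g x / 2) + (p - 1) * ?a \<le> 0"
      unfolding mult.assoc by (simp only: left_diff_distrib right_diff_distrib)
    ultimately show "\<exists>y. (\<psi> has_real_derivative y) (at x) \<and> y \<le> 0"
      by blast
  qed
  moreover have "L 0 = c"
    by (simp add: L_def)
  ultimately have "L T powr (1 - p) + (p - 1) * ?a * T \<le> c powr (1 - p)"
    by (simp add: \<psi>_def)
  then have "(p - 1) * ?a * T \<le> c powr (1 - p)"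
    using powr_ge_zero[of "L T" "1 - p"] by linarith
  then show ?thesis
    by (simp add: mult_ac)
qed

subsection \<open>The mass of a plane wave on a ball\<close>

text \<open>The integrand is sqrt (4 pi \<rho>) times the normal density with mean 0 and variance 2
  \<rho>.\<close>

lemma nn_integral_gaussian:
  assumes "\<rho> > 0"
  shows "(\<integral>\<^sup>+y. ennreal (exp (- y\<^sup>2 / (4 * \<rho>))) \<partial>lborel) = ennreal (sqrt (4 * pi * \<rho>))"
proof -
  have sq: "(sqrt (2 * \<rho>))\<^sup>2 = 2 * \<rho>"
    using assms by simp
  have eq: "exp (- y\<^sup>2 / (4 * \<rho>)) = sqrt (4 * pi * \<rho>) * normal_density 0 (sqrt (2 * \<rho>)) y" for y
    using assms unfolding normal_density_def sq by (simp add: mult_ac)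
  have "(\<integral>\<^sup>+y. ennreal (exp (- y\<^sup>2 / (4 * \<rho>))) \<partial>lborel) =
      ennreal (\<integral>y. sqrt (4 * pi * \<rho>) * normal_density 0 (sqrt (2 * \<rho>)) y \<partial>lborel)"
    unfolding eq using assms by (intro nn_integral_eq_integral) auto
  then show ?thesis
    using assms by simp
qed

lemma nn_integral_exp_half:
  assumes "\<rho> > 0"
  shows "(\<integral>\<^sup>+y. ennreal (exp (y / 2)) * indicator {-\<rho>..\<rho>} y \<partial>lborel) \<le> ennreal (2 * exp (\<rho> / 2))"
proof -
  have "(\<integral>\<^sup>+y. ennreal (exp (y / 2)) * indicator {-\<rho>..\<rho>} y \<partial>lborel) =
      ennreal (2 * exp (\<rho> / 2) - 2 * exp (- \<rho> / 2))"
    using assms by (intro nn_integral_FTC_Icc) (auto intro!: derivative_eq_intros)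
  also have "\<dots> \<le> ennreal (2 * exp (\<rho> / 2))"
    by (intro ennreal_leI) simp
  finally show ?thesis .
qed

text \<open>On the ball of radius \<open>\<rho>\<close> the coordinate \<open>s = x \<bullet> e\<close> and the orthogonal part \<open>y\<close> satisfy
  \<open>s \<le> \<rho> - |y|\<^sup>2 / (2 \<rho>)\<close>. Using this for one half of the exponent \<open>s\<close> gives a majorant that is a
  product of one-dimensional functions.\<close>

lemma nn_integral_exp_cball:
  fixes e :: "'a::euclidean_space"
  assumes e: "e \<in> Basis" and \<rho>: "\<rho> > 0"
  shows "(\<integral>\<^sup>+x. ennreal (exp (x \<bullet> e)) * indicator (cball 0 \<rho>) x \<partial>lborel) \<le>
     ennreal (2 * exp \<rho> * (4 * pi * \<rho>) powr ((real DIM('a) - 1) / 2))"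
proof -
  \<comment> \<open>The half exponent exp (y / 2) is kept in the direction e on purpose: its
    integral over [-\<rho>, \<rho>] is at most 2 exp (\<rho> / 2). Estimating the whole exponent by
    the Gaussian would leave the constant 1 to integrate in that direction and cost an additional
    factor of order \<rho>, which would spoil the power (n-1)/2.\<close>
  define f :: "'a \<Rightarrow> real \<Rightarrow> ennreal" where
    "f = (\<lambda>b y. if b = e then ennreal (exp (y / 2)) * indicator {-\<rho>..\<rho>} y
                   else ennreal (exp (- y\<^sup>2 / (4 * \<rho>))))"
  have bound: "ennreal (exp (x \<bullet> e)) * indicator (cball 0 \<rho>) x \<le>
      ennreal (exp (\<rho> / 2)) * (\<Prod>b\<in>Basis. f b (x \<bullet> b))" for x
  proof (cases "x \<in> cball 0 \<rho>")
    case True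
    define s where "s = x \<bullet> e"
    define q where "q = (\<Sum>b\<in>Basis - {e}. (x \<bullet> b)\<^sup>2)"
    have "(norm x)\<^sup>2 = (\<Sum>b\<in>Basis. (x \<bullet> b)\<^sup>2)"
      by (subst power2_norm_eq_inner, subst euclidean_inner) (simp add: power2_eq_square)
    also have "\<dots> = s\<^sup>2 + q"
      using e by (simp add: sum.remove s_def q_def)
    finally have "s\<^sup>2 + q = (norm x)\<^sup>2"
      by simp
    also have "\<dots> \<le> \<rho>\<^sup>2"
      using True by (intro power_mono) auto
    finally have q: "q \<le> (\<rho> - s) * (\<rho> + s)"
      by (simp add: power2_eq_square algebra_simps)
    have s: "\<bar>s\<bar> \<le> \<rho>"
      using Basis_le_norm[OF e, of x] True by (simp add: s_def)
    have "(\<rho> - s) * (\<rho> + s) \<le> (\<rho> - s) * (2 * \<rho>)"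
      using s by (intro mult_left_mono) auto
    with q have "q / (4 * \<rho>) \<le> (\<rho> - s) / 2"
      using \<rho> by (simp add: field_simps)
    then have le: "exp s \<le> exp (\<rho> / 2) * (exp (s / 2) * exp (- q / (4 * \<rho>)))"
      unfolding exp_add[symmetric] exp_le_cancel_iff by (simp add: field_simps)
    have "(\<Prod>b\<in>Basis - {e}. f b (x \<bullet> b)) = (\<Prod>b\<in>Basis - {e}. ennreal (exp (- (x \<bullet> b)\<^sup>2 / (4 * \<rho>))))"
      by (intro prod.cong) (auto simp: f_def)
    also have "\<dots> = ennreal (exp (\<Sum>b\<in>Basis - {e}. - (x \<bullet> b)\<^sup>2 / (4 * \<rho>)))"
      by (subst prod_ennreal) (auto simp: exp_sum)
    also have "(\<Sum>b\<in>Basis - {e}. - (x \<bullet> b)\<^sup>2 / (4 * \<rho>)) = - q / (4 * \<rho>)"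
      by (simp add: q_def sum_negf sum_divide_distrib)
    finally have "(\<Prod>b\<in>Basis. f b (x \<bullet> b)) = ennreal (exp (s / 2)) * ennreal (exp (- q / (4 * \<rho>)))"
      using e s by (simp add: prod.remove f_def abs_le_iff flip: s_def)
    then have "ennreal (exp (\<rho> / 2)) * (\<Prod>b\<in>Basis. f b (x \<bullet> b)) =
        ennreal (exp (\<rho> / 2) * (exp (s / 2) * exp (- q / (4 * \<rho>))))"
      by (simp add: ennreal_mult)
    with le True show ?thesis
      by (simp add: s_def ennreal_leI)
  qed auto
  have f: "f b \<in> borel_measurable borel" for b
    by (auto simp: f_def)
  have "(\<integral>\<^sup>+x. ennreal (exp (x \<bullet> e)) * indicator (cball 0 \<rho>) x \<partial>lborel) \<le>
      (\<integral>\<^sup>+x. ennreal (exp (\<rho> / 2)) * (\<Prod>b\<in>Basis. f b (x \<bullet> b)) \<partial>lborel)"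
    by (intro nn_integral_mono bound)
  also have "\<dots> = ennreal (exp (\<rho> / 2)) * (\<integral>\<^sup>+x. (\<Prod>b\<in>Basis. f b (x \<bullet> b)) \<partial>lborel)"
    by (intro nn_integral_cmult borel_measurable_prod_ennreal measurable_compose[OF _ f]) auto
  also have "(\<integral>\<^sup>+x. (\<Prod>b\<in>Basis. f b (x \<bullet> b)) \<partial>lborel) = (\<Prod>b\<in>Basis. \<integral>\<^sup>+y. f b y \<partial>lborel)"
    by (intro nn_integral_lborel_prod f) auto
  also have "\<dots> = (\<integral>\<^sup>+y. f e y \<partial>lborel) * (\<Prod>b\<in>Basis - {e}. \<integral>\<^sup>+y. f b y \<partial>lborel)"
    using e by (simp add: prod.remove)
  also have "(\<Prod>b\<in>Basis - {e}. \<integral>\<^sup>+y. f b y \<partial>lborel) = (\<Prod>b\<in>Basis - {e}. ennreal (sqrt (4 * pi * \<rho>)))"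
    using nn_integral_gaussian[OF \<rho>] by (intro prod.cong) (auto simp: f_def)
  also have "\<dots> = ennreal (sqrt (4 * pi * \<rho>) ^ (DIM('a) - 1))"
    using e \<rho> by (simp add: card_Diff_singleton ennreal_power)
  also have "sqrt (4 * pi * \<rho>) ^ (DIM('a) - 1) = (4 * pi * \<rho>) powr ((real DIM('a) - 1) / 2)"
  proof -
    have "sqrt (4 * pi * \<rho>) ^ (DIM('a) - 1) = sqrt (4 * pi * \<rho>) powr real (DIM('a) - 1)"
      using \<rho> by (intro powr_realpow[symmetric]) simp
    also have "\<dots> = (4 * pi * \<rho>) powr (1 / 2 * real (DIM('a) - 1))"
      using \<rho> by (simp add: powr_powr flip: powr_half_sqrt)
    also have "1 / 2 * real (DIM('a) - 1) = (real DIM('a) - 1) / 2"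
      by (simp add: of_nat_diff Suc_leI)
    finally show ?thesis .
  qed
  also have "(\<integral>\<^sup>+y. f e y \<partial>lborel) \<le> ennreal (2 * exp (\<rho> / 2))"
    using nn_integral_exp_half[OF \<rho>] by (simp add: f_def)
  finally have "(\<integral>\<^sup>+x. ennreal (exp (x \<bullet> e)) * indicator (cball 0 \<rho>) x \<partial>lborel) \<le>
      ennreal (exp (\<rho> / 2)) * (ennreal (2 * exp (\<rho> / 2)) *
        ennreal ((4 * pi * \<rho>) powr ((real DIM('a) - 1) / 2)))"
    by (simp add: mult_left_mono mult_right_mono)
  also have "\<dots> = ennreal (2 * (exp (\<rho> / 2) * exp (\<rho> / 2)) * (4 * pi * \<rho>) powr ((real DIM('a) - 1) / 2))"
    by (simp add: mult_ac flip: ennreal_mult)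
  also have "exp (\<rho> / 2) * exp (\<rho> / 2) = exp \<rho>"
    by (simp flip: exp_add)
  finally show ?thesis .
qed

subsection \<open>Smooth cutoff functions\<close>

lemma C_k_SucD: "C_k (Suc m) f \<Longrightarrow> C_k m f"
proof (induction m arbitrary: f)
  case 0
  then have "\<forall>x. f differentiable (at x)"
    by simp
  then show ?case
    by (simp add: continuous_on_eq_continuous_within differentiable_imp_continuous_within)
next
  case (Suc m)
  then show ?case
    by (metis C_k.simps(2))
qed

lemma frechet_derivative_eqI: "(f has_derivative f') (at x) \<Longrightarrow> frechet_derivative f (at x) = f'"
  by (metis frechet_derivative_at)

lemma C_k_SucI:
  assumes "\<And>x. (f has_derivative f' x) (at x)" and "\<And>v. C_k m (\<lambda>x. f' x v)"
  shows "C_k (Suc m) f"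
  using assms by (auto simp: frechet_derivative_eqI[OF assms(1)] intro: differentiableI)

lemma C_k_has_derivative: "C_k (Suc m) f \<Longrightarrow> (f has_derivative frechet_derivative f (at x)) (at x)"
  by (auto simp: frechet_derivative_works)

lemma C_k_const: "C_k m (\<lambda>x. c)"
proof (induction m arbitrary: c)
  case (Suc m)
  show ?case
    by (rule C_k_SucI[where f'="\<lambda>_ _. 0"]) (auto intro: Suc)
qed auto

lemma C_k_add: "C_k m f \<Longrightarrow> C_k m g \<Longrightarrow> C_k m (\<lambda>x. f x + g x)"
proof (induction m arbitrary: f g)
  case (Suc m)
  show ?case
    by (rule C_k_SucI[OF has_derivative_add[OF C_k_has_derivative[OF Suc.prems(1)]
            C_k_has_derivative[OF Suc.prems(2)]]])
      (use Suc in auto)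
qed (auto intro: continuous_intros)

lemma C_k_mult: "C_k m f \<Longrightarrow> C_k m g \<Longrightarrow> C_k m (\<lambda>x. f x * g x)"
proof (induction m arbitrary: f g)
  case (Suc m)
  show ?case
    by (rule C_k_SucI[OF has_derivative_mult[OF C_k_has_derivative[OF Suc.prems(1)]
            C_k_has_derivative[OF Suc.prems(2)]]])
      (use Suc in \<open>auto intro!: C_k_add simp: C_k_SucD\<close>)
qed (auto intro: continuous_intros)

lemma C_k_prod: "(\<And>i. i \<in> I \<Longrightarrow> C_k m (f i)) \<Longrightarrow> C_k m (\<lambda>x. \<Prod>i\<in>I. f i x)"
  by (induction I rule: infinite_finite_induct) (auto intro: C_k_const C_k_mult)

lemma C_k_compose_linear:
  assumes L: "bounded_linear L"
  shows "C_k m f \<Longrightarrow> C_k m (\<lambda>x. f (L x))"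
proof (induction m arbitrary: f)
  case 0
  show ?case
    using 0 by (auto intro!: continuous_on_compose2[of UNIV f] linear_continuous_on[OF L])
next
  case (Suc m)
  show ?case
  proof (rule C_k_SucI)
    show "((\<lambda>x. f (L x)) has_derivative (\<lambda>v. frechet_derivative f (at (L x)) (L v))) (at x)" for x
      by (rule has_derivative_compose[OF bounded_linear_imp_has_derivative[OF L]
            C_k_has_derivative[OF Suc.prems]])
    show "C_k m (\<lambda>x. frechet_derivative f (at (L x)) (L v))" for v
      using Suc.prems by (intro Suc.IH[of "\<lambda>y. frechet_derivative f (at y) (L v)"]) simp
  qed
qed

lemma C_k_inverse:
  assumes "\<And>x. f x \<noteq> 0"
  shows "C_k m f \<Longrightarrow> C_k m (\<lambda>x. inverse (f x))"
proof (induction m)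
  case 0
  then show ?case
    using assms by (auto intro!: continuous_intros)
next
  case (Suc m)
  show ?case
  proof (rule C_k_SucI)
    show "((\<lambda>x. inverse (f x)) has_derivative
        (\<lambda>v. - (inverse (f x) * frechet_derivative f (at x) v * inverse (f x)))) (at x)" for x
      by (rule Deriv.has_derivative_inverse[OF assms C_k_has_derivative[OF Suc.prems]])
    have eq: "(\<lambda>x. - (inverse (f x) * frechet_derivative f (at x) v * inverse (f x))) =
       (\<lambda>x. (-1) * (inverse (f x) * frechet_derivative f (at x) v * inverse (f x)))" for v
      by auto
    show "C_k m (\<lambda>x. - (inverse (f x) * frechet_derivative f (at x) v * inverse (f x)))" for v
      unfolding eq using Suc by (intro C_k_mult C_k_const) (auto simp: C_k_SucD)
  qed
qed

lemma smooth_frechet_derivative: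
  "smooth f \<Longrightarrow> smooth (\<lambda>x. frechet_derivative f (at x) v)"
  unfolding smooth_def by (metis C_k.simps(2))

lemma smooth_continuous: "smooth f \<Longrightarrow> continuous_on S f"
  unfolding smooth_def by (metis C_k.simps(1) continuous_on_subset subset_UNIV)

lemma smooth_mult: "smooth f \<Longrightarrow> smooth g \<Longrightarrow> smooth (\<lambda>x. f x * g x)"
  unfolding smooth_def by (auto intro: C_k_mult)

lemma smooth_compose_linear: "bounded_linear L \<Longrightarrow> smooth f \<Longrightarrow> smooth (\<lambda>x. f (L x))"
  unfolding smooth_def by (auto intro: C_k_compose_linear)

lemma C_k_exp: "C_k m (\<lambda>x::real. c * exp x)"
proof (induction m arbitrary: c)
  case (Suc m)
  show ?case
  proof (rule C_k_SucI)
    show "((\<lambda>x::real. c * exp x) has_derivative (\<lambda>v. c * v * exp x)) (at x)" for x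
      by (auto intro!: derivative_eq_intros simp: algebra_simps)
  qed (rule Suc)
qed (auto intro!: continuous_intros)

lemma smooth_exp: "smooth (exp :: real \<Rightarrow> real)"
  unfolding smooth_def using C_k_exp[of _ 1] by simp

text \<open>For j = 0 this is the classical smooth function e^{-1/x} extended by 0. The powers of
  1/x are included because differentiation leads back into the linear span of the family.\<close>

definition flat :: "nat \<Rightarrow> real \<Rightarrow> real" where
  "flat j x = (if x > 0 then inverse x ^ j * exp (- inverse x) else 0)"

lemma flat_tendsto_0: "(flat j \<longlongrightarrow> 0) (at 0)"
proof -
  have "((\<lambda>y::real. y ^ j / exp y) \<longlongrightarrow> 0) at_top"
    by (rule tendsto_power_div_exp_0)
  then have "((\<lambda>x::real. inverse x ^ j / exp (inverse x)) \<longlongrightarrow> 0) (at_right 0)"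
    by (rule filterlim_compose) (rule filterlim_inverse_at_top_right)
  then have "(flat j \<longlongrightarrow> 0) (at_right 0)"
    by (rule Lim_transform_eventually)
      (auto simp: flat_def eventually_at_filter exp_minus divide_inverse)
  moreover have "(flat j \<longlongrightarrow> 0) (at_left 0)"
    by (rule Lim_transform_eventually[of "\<lambda>_. 0"]) (auto simp: flat_def eventually_at_filter)
  ultimately show ?thesis
    by (simp add: filterlim_split_at)
qed

lemma flat_has_derivative:
  "(flat j has_real_derivative flat (j + 2) x - j * flat (j + 1) x) (at x)"
proof -
  consider "x > 0" | "x < 0" | "x = 0"
    by linarith
  then show ?thesis
  proof cases
    case 1
    have pw: "inverse x ^ n = inverse x * inverse x ^ (n - Suc 0)" if "n \<noteq> 0" for n
      using that by (simp add: power_eq_if)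
    have "((\<lambda>x. inverse x ^ j * exp (- inverse x)) has_real_derivative
        flat (j + 2) x - j * flat (j + 1) x) (at x)"
      using 1
      by (cases j) (auto intro!: derivative_eq_intros
          simp: flat_def algebra_simps power2_eq_square, metis pw)
    then show ?thesis
      by (rule has_field_derivative_transform_within_open[of _ _ _ "{0<..}"])
        (use 1 in \<open>auto simp: flat_def\<close>)
  next
    case 2
    have "((\<lambda>x. 0) has_real_derivative flat (j + 2) x - j * flat (j + 1) x) (at x)"
      using 2 by (auto simp: flat_def)
    then show ?thesis
      by (rule has_field_derivative_transform_within_open[of _ _ _ "{..<0}"])
        (use 2 in \<open>auto simp: flat_def\<close>)
  next
    case 3
    \<comment> \<open>The difference quotient at the origin is the next member
      \<open>flat (Suc j)\<close> of the family, so the same limit 0 settles differentiability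
      there.\<close>
    have "((\<lambda>h. (flat j (0 + h) - flat j 0) / h) \<longlongrightarrow> 0) (at 0)"
      by (rule Lim_transform_eventually[OF flat_tendsto_0[of "Suc j"]])
        (auto simp: flat_def eventually_at_filter divide_inverse)
    then show ?thesis
      using 3 by (simp add: DERIV_def flat_def)
  qed
qed

text \<open>The constant c has to be part of the induction: the derivative in direction v is a
  combination of two members of the family whose coefficients contain c, j and v.\<close>

lemma C_k_flat: "C_k m (\<lambda>x. c * flat j x)"
proof (induction m arbitrary: c j)
  case 0
  show ?case
    by (auto intro!: continuous_intros DERIV_continuous_on[OF flat_has_derivative[THEN
            has_field_derivative_at_within]])
next
  case (Suc m)
  show ?case
  proof (rule C_k_SucI)
    show "((\<lambda>x. c * flat j x) has_derivative
        (\<lambda>v. (c * v) * flat (j + 2) x + (- c * j * v) * flat (j + 1) x)) (at x)" for x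
      by (rule has_derivative_eq_rhs[OF has_derivative_mult_right[OF
              flat_has_derivative[unfolded has_field_derivative_def]]])
        (auto simp: algebra_simps)
    show "C_k m (\<lambda>x. (c * v) * flat (j + 2) x + (- c * j * v) * flat (j + 1) x)" for v
      by (intro C_k_add Suc)
  qed
qed

lemma C_k_shift: "C_k m f \<Longrightarrow> C_k m (\<lambda>x. f (x + a))"
proof (induction m arbitrary: f)
  case 0
  then show ?case
    by (auto intro!: continuous_on_compose2[of UNIV f] continuous_intros)
next
  case (Suc m)
  show ?case
  proof (rule C_k_SucI)
    show "((\<lambda>x. f (x + a)) has_derivative frechet_derivative f (at (x + a))) (at x)" for x
      by (rule has_derivative_compose[OF _ C_k_has_derivative[OF Suc.prems], of "\<lambda>x. x + a"])
        (auto intro!: derivative_eq_intros)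
    show "C_k m (\<lambda>x. frechet_derivative f (at (x + a)) v)" for v
      using Suc.prems by (intro Suc.IH[of "\<lambda>y. frechet_derivative f (at y) v"]) simp
  qed
qed

lemma smooth_affine:
  fixes f :: "real \<Rightarrow> real"
  assumes "smooth f"
  shows "smooth (\<lambda>x. f (a * x + b))"
  unfolding smooth_def
proof
  fix m
  have "C_k m (\<lambda>x. f (x + b))"
    using assms by (auto simp: smooth_def intro: C_k_shift)
  from C_k_compose_linear[OF _ this, of "\<lambda>x. a * x"] show "C_k m (\<lambda>x. f (a * x + b))"
    by (simp add: bounded_linear_mult_right)
qed

text \<open>The step is the quotient of \<open>flat 0 x\<close> by
  \<open>flat 0 x + flat 0 (1 - x)\<close>. The denominator never vanishes, because x and 1 - x
  cannot both be nonpositive.\<close>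

lemma smooth_step_exists:
  obtains g :: "real \<Rightarrow> real"
  where "smooth g" "\<And>x. x \<le> 0 \<Longrightarrow> g x = 0" "\<And>x. x \<ge> 1 \<Longrightarrow> g x = 1" "\<And>x. 0 \<le> g x"
proof
  let ?f = "flat 0" and ?g = "\<lambda>x. flat 0 x * inverse (flat 0 x + flat 0 (-1 * x + 1))"
  have f: "smooth ?f"
    using C_k_flat[of _ 1] by (auto simp: smooth_def)
  have pos: "?f x + ?f (- x + 1) > 0" for x
    by (cases "x > 0") (auto simp: flat_def add_pos_nonneg)
  have ne: "?f x + ?f (-1 * x + 1) \<noteq> 0" for x
    using pos[of x] by simp
  show "smooth ?g"
    using f smooth_affine[OF f, of "-1" 1] unfolding smooth_def
    by (intro allI C_k_mult C_k_inverse C_k_add ne) auto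
  show "?g x = 0" if "x \<le> 0" for x
    using that by (simp add: flat_def)
  show "?g x = 1" if "x \<ge> 1" for x
    using that by (simp add: flat_def)
  show "0 \<le> ?g x" for x
    by (simp add: flat_def)
qed

lemma smooth_cutoff_exists:
  fixes a b \<delta> :: real
  assumes "\<delta> > 0"
  obtains h where "smooth h" "\<And>x. x \<in> {a..b} \<Longrightarrow> h x = 1" "\<And>x. x \<notin> {a-\<delta>..b+\<delta>} \<Longrightarrow> h x = 0"
    "\<And>x. 0 \<le> h x"
proof -
  obtain g :: "real \<Rightarrow> real"
    where g: "smooth g" "\<And>x. x \<le> 0 \<Longrightarrow> g x = 0" "\<And>x. x \<ge> 1 \<Longrightarrow> g x = 1" "\<And>x. 0 \<le> g x"
    using smooth_step_exists by metis
  \<comment> \<open>A step rising on [a - \<delta>, a] times a step falling on [b, b + \<delta>],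
    with arguments written in the form that \<open>smooth_affine\<close> expects.\<close>
  let ?h = "\<lambda>x. g ((1/\<delta>) * x + (1 - a/\<delta>)) * g ((-1/\<delta>) * x + (1 + b/\<delta>))"
  have eqs: "(1/\<delta>) * x + (1 - a/\<delta>) = (x + \<delta> - a) / \<delta>"
    "(-1/\<delta>) * x + (1 + b/\<delta>) = (b + \<delta> - x) / \<delta>" for x
    using assms by (auto simp: field_simps)
  show thesis
  proof
    show "smooth ?h"
      by (intro smooth_mult smooth_affine g(1))
    show "?h x = 1" if "x \<in> {a..b}" for x
    proof -
      have "(x + \<delta> - a) / \<delta> \<ge> 1" "(b + \<delta> - x) / \<delta> \<ge> 1"
        using that assms by (auto simp: field_simps)
      then show ?thesis
        using g(3) unfolding eqs by simp
    qed
    show "?h x = 0" if "x \<notin> {a-\<delta>..b+\<delta>}" for x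
    proof (cases "x < a - \<delta>")
      case True
      then have "(x + \<delta> - a) / \<delta> \<le> 0"
        using assms by (intro divide_nonpos_pos) auto
      then show ?thesis
        using g(2) unfolding eqs by simp
    next
      case False
      then have "(b + \<delta> - x) / \<delta> \<le> 0"
        using assms that by (intro divide_nonpos_pos) auto
      then show ?thesis
        using g(2) unfolding eqs by simp
    qed
    show "0 \<le> ?h x" for x
      using g(4) by simp
  qed
qed

subsection \<open>Locally integrable functions\<close>

text \<open>Completeness of the measure is what makes an almost everywhere modification measurable
  again; nothing about g is assumed beyond the agreement.\<close>

lemma borel_measurable_completion_cong_AE:
  fixes f g :: "'a \<Rightarrow> 'b::topological_space"
  assumes f: "f \<in> borel_measurable (completion M)" and ae: "AE x in completion M. f x = g x"
  shows "g \<in> borel_measurable (completion M)"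
proof (rule measurableI)
  fix A :: "'b set" assume A: "A \<in> sets borel"
  show "g -` A \<inter> space (completion M) \<in> sets (completion M)"
  proof (rule completion.in_sets_AE)
    show "AE x in completion M. (x \<in> f -` A \<inter> space (completion M)) =
        (x \<in> g -` A \<inter> space (completion M))"
      using ae by eventually_elim auto
  qed (use measurable_sets[OF f A] in auto)
qed auto

text \<open>Lebesgue measure on the product is the completion of the product of Borel-Lebesgue
  measures, so Fubini is applied to a Borel representative G'. For almost every s the sections of G
  and G' agree almost everywhere, and this transfers both claims back to G.\<close>

lemma lebesgue_Fubini:
  fixes G :: "'a::euclidean_space \<times> 'b::euclidean_space \<Rightarrow> real"
  assumes G: "integrable lebesgue G"
  shows "AE s in lebesgue. integrable lebesgue (\<lambda>x. G (s, x))"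
    and "integrable lebesgue (\<lambda>s. LINT x|lebesgue. G (s, x))"
proof -
  obtain G' where G': "G' \<in> borel_measurable lborel" "AE z in lborel. G z = G' z"
    using completion_ex_borel_measurable_real[of G lborel] G by auto
  have "integrable lebesgue G'"
    using G G' by (subst integrable_cong_AE[of _ _ G])
      (auto intro: AE_completion measurable_completion elim: eventually_mono)
  then have "integrable lborel G'"
    using G'(1) by (simp add: integrable_completion)
  then have int: "integrable (lborel \<Otimes>\<^sub>M lborel) G'"
    by (simp add: lborel_prod)
  have "AE z in lborel \<Otimes>\<^sub>M lborel. G z = G' z"
    by (subst lborel_prod) (rule G'(2))
  then have eq: "AE s in lborel. AE x in lborel. G (s, x) = G' (s, x)"
    by (rule lborel_pair.AE_pair)
  have sec: "AE s in lborel. integrable lborel (\<lambda>x. G' (s, x))"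
    by (rule lborel_pair.AE_integrable_fst'[OF int])
  have *: "AE s in lborel. integrable lebesgue (\<lambda>x. G (s, x)) \<and>
      (LINT x|lebesgue. G (s, x)) = (LINT x|lborel. G' (s, x))"
    using eq sec
  proof eventually_elim
    case (elim s)
    have meas: "(\<lambda>x. G' (s, x)) \<in> borel_measurable lborel"
      using elim(2) by auto
    have ae: "AE x in lebesgue. G' (s, x) = G (s, x)"
      using AE_completion[OF elim(1)] by eventually_elim simp
    have 1: "(\<lambda>x. G' (s, x)) \<in> borel_measurable lebesgue"
      using meas by (rule measurable_completion)
    have 2: "(\<lambda>x. G (s, x)) \<in> borel_measurable lebesgue"
      using 1 ae by (rule borel_measurable_completion_cong_AE)
    have "integrable lebesgue (\<lambda>x. G' (s, x))"
      using elim(2) meas by (simp add: integrable_completion)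
    then show ?case
      using integrable_cong_AE[OF 1 2 ae] integral_cong_AE[OF 1 2 ae] integral_completion[OF meas]
      by simp
  qed
  show "AE s in lebesgue. integrable lebesgue (\<lambda>x. G (s, x))"
    using AE_completion[OF *] by eventually_elim simp
  have int': "integrable lborel (\<lambda>s. LINT x|lborel. G' (s, x))"
    by (rule lborel_pair.integrable_fst'[OF int])
  then have 1: "(\<lambda>s. LINT x|lborel. G' (s, x)) \<in> borel_measurable lebesgue"
    by (intro measurable_completion) auto
  have ae: "AE s in lebesgue. (LINT x|lborel. G' (s, x)) = (LINT x|lebesgue. G (s, x))"
    using AE_completion[OF *] by eventually_elim simp
  have 2: "(\<lambda>s. LINT x|lebesgue. G (s, x)) \<in> borel_measurable lebesgue"
    using 1 ae by (rule borel_measurable_completion_cong_AE)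
  show "integrable lebesgue (\<lambda>s. LINT x|lebesgue. G (s, x))"
    using int' integrable_cong_AE[OF 1 2 ae]
    by (simp add: integrable_completion borel_measurable_integrable)
qed

text \<open>The complement of the essential support is a union of open sets on which f vanishes
  almost everywhere. The union may be uncountable; the Lindelof property reduces it to a countable
  one, over which null sets can be collected.\<close>

lemma AE_zero_outside_ess_support:
  "AE x in lebesgue. x \<notin> ess_support f \<longrightarrow> f x = 0"
proof -
  define \<F> where "\<F> = {U. open U \<and> (AE y in lebesgue. y \<in> U \<longrightarrow> f y = 0)}"
  obtain \<F>' where F': "\<F>' \<subseteq> \<F>" "countable \<F>'" "\<Union>\<F>' = \<Union>\<F>"
    by (rule Lindelof[of \<F>]) (auto simp: \<F>_def)
  have "AE x in lebesgue. \<forall>U\<in>\<F>'. x \<in> U \<longrightarrow> f x = 0"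
    using F'(1,2) by (intro AE_ball_countable') (auto simp: \<F>_def)
  moreover have "\<Union>\<F>' = - ess_support f"
    unfolding F'(3) by (auto simp: \<F>_def ess_support_def)
  ultimately show ?thesis
    by (auto elim!: eventually_mono)
qed

lemma AE_zero_if_ess_support_subset:
  "ess_support f \<subseteq> S \<Longrightarrow> AE x in lebesgue. x \<notin> S \<longrightarrow> f x = 0"
  using AE_zero_outside_ess_support[of f] by eventually_elim auto

lemma continuous_borel_measurable_lebesgue:
  fixes \<zeta> :: "'a::euclidean_space \<Rightarrow> real"
  shows "continuous_on UNIV \<zeta> \<Longrightarrow> \<zeta> \<in> borel_measurable lebesgue"
  by (intro measurable_completion) (simp add: borel_measurable_continuous_onI)

lemma set_integrable_mult_continuous:
  fixes f \<zeta> :: "'a::euclidean_space \<Rightarrow> real"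
  assumes K: "compact K" and f: "set_integrable lebesgue K f" and \<zeta>: "continuous_on UNIV \<zeta>"
  shows "set_integrable lebesgue K (\<lambda>x. f x * \<zeta> x)"
proof -
  have "bounded (\<zeta> ` K)"
    by (intro compact_imp_bounded compact_continuous_image continuous_on_subset[OF \<zeta>] K) auto
  then obtain M where M: "\<And>x. x \<in> K \<Longrightarrow> \<bar>\<zeta> x\<bar> \<le> M"
    unfolding bounded_iff by (metis imageI real_norm_def)
  have [measurable]: "\<zeta> \<in> borel_measurable lebesgue"
    by (rule continuous_borel_measurable_lebesgue[OF \<zeta>])
  have fK: "integrable lebesgue (\<lambda>x. indicator K x * f x)"
    using f by (simp add: set_integrable_def)
  have "integrable lebesgue (\<lambda>x. indicator K x * f x * \<zeta> x)"
  proof (rule Bochner_Integration.integrable_bound)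
    show "integrable lebesgue (\<lambda>x. M * (indicator K x * f x))"
      using fK by simp
    show "(\<lambda>x. indicator K x * f x * \<zeta> x) \<in> borel_measurable lebesgue"
      using borel_measurable_integrable[OF fK] by measurable
    have "\<bar>\<zeta> x\<bar> * \<bar>f x\<bar> \<le> \<bar>M\<bar> * \<bar>f x\<bar>" if "x \<in> K" for x
      using M[OF that] by (intro mult_right_mono) auto
    then show "AE x in lebesgue. norm (indicator K x * f x * \<zeta> x) \<le> norm (M * (indicator K x * f x))"
      by (auto simp: indicator_def abs_mult mult.commute)
  qed
  then show ?thesis
    by (simp add: set_integrable_def mult.assoc)
qed

lemma integrable_mult_compact_support:
  fixes f \<zeta> :: "'a::euclidean_space \<Rightarrow> real"
  assumes f: "L1_loc UNIV f" and \<zeta>: "continuous_on UNIV \<zeta>"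
    and K: "compact K" "\<And>x. x \<notin> K \<Longrightarrow> \<zeta> x = 0"
  shows "integrable lebesgue (\<lambda>x. f x * \<zeta> x)"
proof -
  have "set_integrable lebesgue K (\<lambda>x. f x * \<zeta> x)"
    using f K(1) \<zeta> by (intro set_integrable_mult_continuous) (auto simp: L1_loc_def)
  moreover have "(\<lambda>x. indicator K x *\<^sub>R (f x * \<zeta> x)) = (\<lambda>x. f x * \<zeta> x)"
  proof
    show "indicator K x *\<^sub>R (f x * \<zeta> x) = f x * \<zeta> x" for x
      using K(2)[of x] by (cases "x \<in> K") auto
  qed
  ultimately show ?thesis
    by (simp add: set_integrable_def)
qed

lemma abs_integral_mult_le:
  fixes f \<zeta> :: "'a::euclidean_space \<Rightarrow> real"
  assumes f: "L1_loc UNIV f" and \<zeta>: "continuous_on UNIV \<zeta>"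
    and K: "compact K" "\<And>x. x \<notin> K \<Longrightarrow> \<zeta> x = 0" and M: "\<And>x. \<bar>\<zeta> x\<bar> \<le> M"
  shows "\<bar>LINT x|lebesgue. f x * \<zeta> x\<bar> \<le> M * (LINT x:K|lebesgue. \<bar>f x\<bar>)"
proof -
  have fK: "set_integrable lebesgue K (\<lambda>x. \<bar>f x\<bar>)"
    using f K(1) by (auto simp: L1_loc_def intro!: set_integrable_abs)
  have "\<bar>LINT x|lebesgue. f x * \<zeta> x\<bar> \<le> (LINT x|lebesgue. \<bar>f x * \<zeta> x\<bar>)"
    by (rule integral_abs_bound)
  also have "\<dots> \<le> (LINT x|lebesgue. M * (indicator K x * \<bar>f x\<bar>))"
  proof (rule integral_mono)
    show "integrable lebesgue (\<lambda>x. \<bar>f x * \<zeta> x\<bar>)"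
      using integrable_mult_compact_support[OF f \<zeta> K] by simp
    show "integrable lebesgue (\<lambda>x. M * (indicator K x * \<bar>f x\<bar>))"
      using fK by (simp add: set_integrable_def)
    show "\<bar>f x * \<zeta> x\<bar> \<le> M * (indicator K x * \<bar>f x\<bar>)" for x
      using mult_right_mono[OF M[of x], of "\<bar>f x\<bar>"] K(2)[of x]
      by (auto simp: indicator_def abs_mult mult.commute)
  qed
  also have "\<dots> = M * (LINT x:K|lebesgue. \<bar>f x\<bar>)"
    by (simp add: set_lebesgue_integral_def)
  finally show ?thesis .
qed

lemma bounded_compact_support:
  fixes \<zeta> :: "'a::euclidean_space \<Rightarrow> real"
  assumes \<zeta>: "continuous_on UNIV \<zeta>" and K: "compact K" "\<And>x. x \<notin> K \<Longrightarrow> \<zeta> x = 0"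
  obtains M where "M > 0" "\<And>x. \<bar>\<zeta> x\<bar> \<le> M"
proof -
  have "bounded (\<zeta> ` K)"
    by (intro compact_imp_bounded compact_continuous_image continuous_on_subset[OF \<zeta>] K) auto
  then obtain M where M: "\<And>x. x \<in> K \<Longrightarrow> \<bar>\<zeta> x\<bar> \<le> M"
    unfolding bounded_iff by (metis imageI real_norm_def)
  have "\<bar>\<zeta> x\<bar> \<le> max M 1" for x
    using M[of x] K(2)[of x] by (cases "x \<in> K") auto
  then show thesis
    by (intro that[of "max M 1"]) auto
qed

section \<open>Pairing time-dependent functions with a fixed cutoff\<close>

lemma L1_loc_diff: "L1_loc S f \<Longrightarrow> L1_loc S g \<Longrightarrow> L1_loc S (\<lambda>x. f x - g x)"
  by (auto simp: L1_loc_def)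

lemma L1_loc_divide: "L1_loc S f \<Longrightarrow> L1_loc S (\<lambda>x. f x / (c::real))"
  by (auto simp: L1_loc_def)

lemma continuous_on_pairing:
  fixes v :: "real \<Rightarrow> real^'n \<Rightarrow> real"
  assumes v: "continuous_L1_loc T v" and \<zeta>: "continuous_on UNIV \<zeta>"
    and K: "compact K" "\<And>x. x \<notin> K \<Longrightarrow> \<zeta> x = 0"
  shows "continuous_on (time_interval T) (\<lambda>t. LINT x|lebesgue. v t x * \<zeta> x)"
  unfolding continuous_on_def
proof
  fix t assume t: "t \<in> time_interval T"
  obtain M where M: "M > 0" "\<And>x. \<bar>\<zeta> x\<bar> \<le> M"
    using bounded_compact_support[OF \<zeta> K] by blast
  have L: "L1_loc UNIV (v s)" if "s \<in> time_interval T" for s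
    using v that by (auto simp: continuous_L1_loc_def)
  have "((\<lambda>s. M * (LINT x:K|lebesgue. \<bar>v s x - v t x\<bar>)) \<longlongrightarrow> M * 0) (at t within time_interval T)"
    using v t K(1) by (intro tendsto_mult_left) (auto simp: continuous_L1_loc_def)
  then have lim: "((\<lambda>s. M * (LINT x:K|lebesgue. \<bar>v s x - v t x\<bar>)) \<longlongrightarrow> 0)
      (at t within time_interval T)"
    by simp
  have "((\<lambda>s. (LINT x|lebesgue. v s x * \<zeta> x) - (LINT x|lebesgue. v t x * \<zeta> x)) \<longlongrightarrow> 0)
      (at t within time_interval T)"
  proof (rule Lim_null_comparison[OF _ lim])
    show "\<forall>\<^sub>F s in at t within time_interval T.
        norm ((LINT x|lebesgue. v s x * \<zeta> x) - (LINT x|lebesgue. v t x * \<zeta> x))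
          \<le> M * (LINT x:K|lebesgue. \<bar>v s x - v t x\<bar>)"
      unfolding eventually_at_filter
    proof (rule always_eventually, intro allI impI)
      fix s assume s: "s \<in> time_interval T"
      have "(LINT x|lebesgue. v s x * \<zeta> x) - (LINT x|lebesgue. v t x * \<zeta> x) =
          (LINT x|lebesgue. (v s x - v t x) * \<zeta> x)"
        unfolding left_diff_distrib
        by (intro Bochner_Integration.integral_diff[symmetric]
            integrable_mult_compact_support[OF _ \<zeta> K] L s t)
      then show "norm ((LINT x|lebesgue. v s x * \<zeta> x) - (LINT x|lebesgue. v t x * \<zeta> x))
          \<le> M * (LINT x:K|lebesgue. \<bar>v s x - v t x\<bar>)"
        using abs_integral_mult_le[OF L1_loc_diff[OF L[OF s] L[OF t]] \<zeta> K M(2)] by simp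
    qed
  qed
  then show "((\<lambda>t. LINT x|lebesgue. v t x * \<zeta> x) \<longlongrightarrow> (LINT x|lebesgue. v t x * \<zeta> x))
      (at t within time_interval T)"
    by (rule LIM_zero_cancel)
qed

text \<open>By \<open>abs_integral_mult_le\<close>, pairing with \<zeta> is bounded by a multiple of
  the L^1 norm on K, so the convergence of the difference quotients in L^1(K) passes to the
  pairings.\<close>

lemma has_derivative_pairing:
  fixes v w :: "real \<Rightarrow> real^'n \<Rightarrow> real"
  assumes v: "continuous_L1_loc T v" and w: "continuous_L1_loc T w"
    and d: "derivative_L1_loc T v w" and \<zeta>: "continuous_on UNIV \<zeta>"
    and K: "compact K" "\<And>x. x \<notin> K \<Longrightarrow> \<zeta> x = 0" and t: "t \<in> time_interval T"
  shows "((\<lambda>t. LINT x|lebesgue. v t x * \<zeta> x) has_real_derivative (LINT x|lebesgue. w t x * \<zeta> x))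
    (at t within time_interval T)"
proof -
  obtain M where M: "M > 0" "\<And>x. \<bar>\<zeta> x\<bar> \<le> M"
    using bounded_compact_support[OF \<zeta> K] by blast
  have L: "L1_loc UNIV (v s)" "L1_loc UNIV (w s)" if "s \<in> time_interval T" for s
    using v w that by (auto simp: continuous_L1_loc_def)
  let ?B = "\<lambda>t. LINT x|lebesgue. v t x * \<zeta> x" and ?A = "LINT x|lebesgue. w t x * \<zeta> x"
  let ?q = "\<lambda>s x. (v s x - v t x) / (s - t) - w t x"
  have "((\<lambda>s. M * (LINT x:K|lebesgue. \<bar>?q s x\<bar>)) \<longlongrightarrow> M * 0) (at t within time_interval T)"
    using d t K(1) by (intro tendsto_mult_left) (auto simp: derivative_L1_loc_def)
  then have lim: "((\<lambda>s. M * (LINT x:K|lebesgue. \<bar>?q s x\<bar>)) \<longlongrightarrow> 0) (at t within time_interval T)"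
    by simp
  have "((\<lambda>s. (?B s - ?B t) / (s - t) - ?A) \<longlongrightarrow> 0) (at t within time_interval T)"
  proof (rule Lim_null_comparison[OF _ lim])
    show "\<forall>\<^sub>F s in at t within time_interval T.
        norm ((?B s - ?B t) / (s - t) - ?A) \<le> M * (LINT x:K|lebesgue. \<bar>?q s x\<bar>)"
      unfolding eventually_at_filter
    proof (rule always_eventually, intro allI impI)
      fix s assume s: "s \<in> time_interval T"
      note int = integrable_mult_compact_support[OF _ \<zeta> K]
      have "(LINT x|lebesgue. ?q s x * \<zeta> x) =
          (LINT x|lebesgue. (v s x * \<zeta> x - v t x * \<zeta> x) / (s - t) - w t x * \<zeta> x)"
        by (simp add: left_diff_distrib)
      also have "\<dots> = (?B s - ?B t) / (s - t) - ?A"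
        using int[OF L(1)[OF s]] int[OF L(1)[OF t]] int[OF L(2)[OF t]] by simp
      finally show "norm ((?B s - ?B t) / (s - t) - ?A) \<le> M * (LINT x:K|lebesgue. \<bar>?q s x\<bar>)"
        using abs_integral_mult_le[OF L1_loc_diff[OF L1_loc_divide[OF L1_loc_diff[OF L(1)[OF s]
                  L(1)[OF t]]] L(2)[OF t]] \<zeta> K M(2), of "s - t"] by simp
    qed
  qed
  then show ?thesis
    unfolding has_field_derivative_iff by (rule LIM_zero_cancel)
qed

text \<open>If a compact set K has distance more than \<delta> from the ball of radius R + t, then v
  vanishes almost everywhere on K at all times closer to t than \<delta>. The difference quotient is
  then zero on K, and the integral of |w t| over K is a constant that tends to 0.\<close>

lemma derivative_vanishes_outside_cone:
  fixes v w :: "real \<Rightarrow> real^'n \<Rightarrow> real"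
  assumes w: "continuous_L1_loc T w"
    and d: "derivative_L1_loc T v w"
    and supp: "\<And>s. s \<in> time_interval T \<Longrightarrow> AE x in lebesgue. x \<notin> cball 0 (R + s) \<longrightarrow> v s x = 0"
    and t: "t \<in> time_interval T"
  shows "AE x in lebesgue. x \<notin> cball 0 (R + t) \<longrightarrow> w t x = 0"
proof -
  obtain t' where t': "t < t'" "ereal t' < T"
    using ereal_dense2[of "ereal t" T] t unfolding time_interval_def
    by (metis less_ereal.simps(1) mem_Collect_eq)
  \<comment> \<open>A constant function has a unique limit only if t is a limit point of the time
    interval. It is one from the right, since the interval does not contain T; this covers t = 0 as
    well.\<close>
  have nontriv: "at t within time_interval T \<noteq> bot"
  proof -
    have "{t<..<t'} \<subseteq> time_interval T"
    proof
      fix x assume x: "x \<in> {t<..<t'}"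
      then have "ereal x < ereal t'"
        by simp
      also note t'(2)
      finally show "x \<in> time_interval T"
        using x t by (simp add: time_interval_def)
    qed
    moreover have "t islimpt {t<..<t'}"
      using t'(1) by (rule islimpt_greaterThanLessThan1)
    ultimately have "t islimpt time_interval T"
      by (rule islimpt_subset[rotated])
    then show ?thesis
      by (simp add: trivial_limit_within)
  qed
  have vanish: "AE x in lebesgue. x \<in> K \<longrightarrow> w t x = 0"
    if K: "compact K" "K \<inter> cball 0 (R + t + \<delta>) = {}" "\<delta> > 0" for K \<delta>
  proof -
    have L: "set_integrable lebesgue K (w t)"
      using w t K(1) by (auto simp: continuous_L1_loc_def L1_loc_def)
    have int: "integrable lebesgue (\<lambda>x. indicator K x * \<bar>w t x\<bar>)"
      using set_integrable_abs[OF L] by (simp add: set_integrable_def)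
    have "((\<lambda>s. LINT x:K|lebesgue. \<bar>(v s x - v t x) / (s - t) - w t x\<bar>) \<longlongrightarrow> 0)
        (at t within time_interval T)"
      using d t K(1) by (auto simp: derivative_L1_loc_def)
    moreover have "\<forall>\<^sub>F s in at t within time_interval T.
        (LINT x:K|lebesgue. \<bar>(v s x - v t x) / (s - t) - w t x\<bar>) = (LINT x|lebesgue. indicator K x * \<bar>w t x\<bar>)"
      unfolding eventually_at
    proof (intro exI[of _ \<delta>] conjI ballI impI)
      fix s assume s: "s \<in> time_interval T" "s \<noteq> t \<and> dist s t < \<delta>"
      have ae: "AE x in lebesgue. indicator K x * \<bar>w t x\<bar> =
          indicator K x *\<^sub>R \<bar>(v s x - v t x) / (s - t) - w t x\<bar>"
        using supp[OF s(1)] supp[OF t]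
      proof eventually_elim
        case (elim x)
        have "x \<notin> cball 0 (R + s)" "x \<notin> cball 0 (R + t)" if "x \<in> K"
        proof -
          have "R + t + \<delta> < norm x"
            using that K(2) by (auto simp: disjoint_iff not_le)
          then show "x \<notin> cball 0 (R + s)" "x \<notin> cball 0 (R + t)"
            using K(3) s(2) by (auto simp: dist_real_def)
        qed
        with elim show ?case
          by (auto simp: indicator_def)
      qed
      have meas: "(\<lambda>x. indicator K x * \<bar>w t x\<bar>) \<in> borel_measurable lebesgue"
        using int by auto
      show "(LINT x:K|lebesgue. \<bar>(v s x - v t x) / (s - t) - w t x\<bar>) = (LINT x|lebesgue. indicator K x * \<bar>w t x\<bar>)"
        unfolding set_lebesgue_integral_def
        by (rule integral_cong_AE[symmetric, OF meas borel_measurable_completion_cong_AE[OF meas ae] ae])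
    qed fact
    ultimately have "((\<lambda>s. LINT x|lebesgue. indicator K x * \<bar>w t x\<bar>) \<longlongrightarrow> 0) (at t within time_interval T)"
      by (rule Lim_transform_eventually)
    then have "(LINT x|lebesgue. indicator K x * \<bar>w t x\<bar>) = 0"
      by (rule tendsto_const_iff[OF nontriv, THEN iffD1])
    then have "AE x in lebesgue. indicator K x * \<bar>w t x\<bar> = 0"
      using integral_nonneg_eq_0_iff_AE[OF int] by simp
    then show ?thesis
      by eventually_elim (auto simp: indicator_eq_0_iff)
  qed
  \<comment> \<open>Countably many compact shells exhaust the complement of the closed ball. Their
    inner radius exceeds R + t by 2 / (n + 1), which leaves room for \<delta> = 1 / (n + 1) and a
    gap.\<close>
  have "AE x in lebesgue. \<forall>n::nat. \<forall>m::nat.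
      x \<in> cball 0 (real m) - ball 0 (R + t + 2 / real (Suc n)) \<longrightarrow> w t x = 0"
    unfolding AE_all_countable
  proof (intro allI vanish)
    fix m n :: nat
    show "compact (cball 0 (real m) - ball 0 (R + t + 2 / real (Suc n)) :: (real^'n) set)"
      by (intro compact_diff) auto
    show "(cball 0 (real m) - ball 0 (R + t + 2 / real (Suc n)) :: (real^'n) set) \<inter>
        cball 0 (R + t + 1 / real (Suc n)) = {}"
    proof -
      have "1 / real (Suc n) < 2 / real (Suc n)"
        by (simp add: divide_strict_right_mono)
      then have "ball 0 (R + t + 2 / real (Suc n)) \<supseteq> (cball 0 (R + t + 1 / real (Suc n)) :: (real^'n) set)"
        by (auto simp del: of_nat_Suc)
      then show ?thesis
        by blast
    qed
  qed auto
  then show ?thesis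
  proof eventually_elim
    case (elim x)
    show ?case
    proof
      assume "x \<notin> cball 0 (R + t)"
      then have pos: "(norm x - (R + t)) / 2 > 0"
        by simp
      obtain n where n: "inverse (real (Suc n)) < (norm x - (R + t)) / 2"
        using reals_Archimedean[OF pos] by blast
      obtain m :: nat where "norm x \<le> real m"
        using real_arch_simple by blast
      moreover have "R + t + 2 / real (Suc n) \<le> norm x"
      proof -
        have *: "a + 2 * z \<le> b" if "z < (b - a) / 2" for a b z :: real
          using that by (simp add: field_simps)
        show ?thesis
          unfolding divide_inverse[of 2] by (rule *[OF n])
      qed
      ultimately have "x \<in> cball 0 (real m) - ball 0 (R + t + 2 / real (Suc n))"
        by simp
      then show "w t x = 0"
        using elim by blast
    qed
  qed
qed

subsection \<open>The weak formulation tested with a plane wave\<close>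

lemma test_functionI:
  assumes "smooth \<phi>" "compact K" "K \<subseteq> \<Omega>" "\<And>x. x \<notin> K \<Longrightarrow> \<phi> x = 0"
  shows "test_function \<Omega> \<phi>"
proof -
  have "closure {x. \<phi> x \<noteq> 0} \<subseteq> K"
    using assms(2,4) by (intro closure_minimal compact_imp_closed) auto
  moreover from this have "compact (closure {x. \<phi> x \<noteq> 0})"
    using assms(2) compact_closure bounded_subset compact_imp_bounded
    by (metis closure_closure closure_subset compact_eq_bounded_closed closed_closure)
  ultimately show ?thesis
    using assms(1,3) by (auto simp: test_function_def)
qed

lemma test_function_product:
  fixes \<zeta> :: "'a::euclidean_space \<Rightarrow> real"
  assumes "smooth \<eta>" "\<And>s. s \<notin> {a..b} \<Longrightarrow> \<eta> s = 0" "ereal b < T"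
    and "smooth \<zeta>" "compact K" "\<And>x. x \<notin> K \<Longrightarrow> \<zeta> x = 0"
  shows "test_function {(s, x). ereal s < T} (\<lambda>(s, x). \<eta> s * \<zeta> x)"
proof (rule test_functionI)
  have "smooth (\<lambda>z. \<eta> (fst z) * \<zeta> (snd z))"
    by (intro smooth_mult smooth_compose_linear[OF bounded_linear_fst]
        smooth_compose_linear[OF bounded_linear_snd] assms)
  then show "smooth (\<lambda>(s, x). \<eta> s * \<zeta> x)"
    by (simp add: case_prod_beta')
  show "compact ({a..b} \<times> K)"
    using assms(5) by (intro compact_Times) auto
  show "{a..b} \<times> K \<subseteq> {(s, x). ereal s < T}"
  proof clarsimp
    fix s assume "s \<le> b"
    then have "ereal s \<le> ereal b"
      by simp
    also note assms(3)
    finally show "ereal s < T" .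
  qed
  show "(case z of (s, x) \<Rightarrow> \<eta> s * \<zeta> x) = 0" if "z \<notin> {a..b} \<times> K" for z
    using that assms(2,6) by (cases z) auto
qed

text \<open>No differentiability is assumed: f and g admit the same linear maps as derivatives at x,
  so the choice operator behind \<open>frechet_derivative\<close> returns the same value for
  both.\<close>

lemma frechet_derivative_cong_open:
  assumes "open U" "x \<in> U" "\<And>y. y \<in> U \<Longrightarrow> f y = g y"
  shows "frechet_derivative f (at x) = frechet_derivative g (at x)"
proof -
  have "(f has_derivative D) (at x) \<longleftrightarrow> (g has_derivative D) (at x)" for D
    using has_derivative_transform_within_open[OF _ assms(1,2), of f D UNIV g]
      has_derivative_transform_within_open[OF _ assms(1,2), of g D UNIV f] assms(3)
    by auto
  then show ?thesis
    by (simp add: frechet_derivative_def)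
qed

section \<open>Derivatives of cutoffs and integration by parts\<close>

lemma smooth_grad_component: "smooth \<zeta> \<Longrightarrow> smooth (\<lambda>x. grad \<zeta> x $ i)"
  by (simp add: grad_def smooth_frechet_derivative)

lemma grad_zero_outside:
  assumes "compact K" "\<And>x. x \<notin> K \<Longrightarrow> \<zeta> x = 0" "x \<notin> K"
  shows "grad \<zeta> x $ i = 0"
proof -
  have "frechet_derivative \<zeta> (at x) = frechet_derivative (\<lambda>_. 0) (at x)"
    by (rule frechet_derivative_cong_open[of "- K"])
      (use assms in \<open>auto intro: compact_imp_closed\<close>)
  also have "\<dots> = (\<lambda>_. 0)"
    by (intro frechet_derivative_eqI) simp
  finally show ?thesis
    by (simp add: grad_def)
qed

text \<open>Written as an iterated \<open>grad\<close>, so that every summand has the shape in which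
  \<open>weak_gradient\<close> integrates by parts.\<close>

definition laplacian :: "(real^'n \<Rightarrow> real) \<Rightarrow> real^'n \<Rightarrow> real" where
  "laplacian \<zeta> x = (\<Sum>i\<in>UNIV. grad (\<lambda>y. grad \<zeta> y $ i) x $ i)"

lemma continuous_laplacian: "smooth \<zeta> \<Longrightarrow> continuous_on S (laplacian \<zeta>)"
  unfolding laplacian_def[abs_def]
  by (intro continuous_on_sum smooth_continuous smooth_grad_component)

lemma laplacian_zero_outside:
  assumes "compact K" "\<And>x. x \<notin> K \<Longrightarrow> \<zeta> x = 0" "x \<notin> K"
  shows "laplacian \<zeta> x = 0"
  unfolding laplacian_def
proof (rule sum.neutral, rule ballI)
  fix i
  show "grad (\<lambda>y. grad \<zeta> y $ i) x $ i = 0"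
    by (rule grad_zero_outside[OF assms(1) _ assms(3)]) (rule grad_zero_outside[OF assms(1,2)])
qed

text \<open>The partial derivatives of \<zeta> are themselves test functions. Inserting the i-th one
  into the definition of the weak gradient in direction i and summing over i gives the
  identity.\<close>

lemma weak_gradient_laplacian:
  fixes f \<zeta> :: "real^'n \<Rightarrow> real"
  assumes fg: "weak_gradient f g" and \<zeta>: "smooth \<zeta>"
    and K: "compact K" "\<And>x. x \<notin> K \<Longrightarrow> \<zeta> x = 0"
  shows "(LINT x|lebesgue. g x \<bullet> grad \<zeta> x) = - (LINT x|lebesgue. f x * laplacian \<zeta> x)"
    and "integrable lebesgue (\<lambda>x. g x \<bullet> grad \<zeta> x)"
proof -
  have f: "L1_loc UNIV f" and g: "L1_loc UNIV g"
    using fg by (auto simp: weak_gradient_def)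
  have gi: "L1_loc UNIV (\<lambda>x. g x $ i)" for i
    unfolding L1_loc_def
  proof (intro allI impI)
    fix C :: "(real^'n) set" assume "compact C \<and> C \<subseteq> UNIV"
    then have "g absolutely_integrable_on C"
      using g by (simp add: L1_loc_def)
    from absolutely_integrable_component[OF this, of "axis i 1"]
    show "(\<lambda>x. g x $ i) absolutely_integrable_on C"
      by (simp add: inner_axis)
  qed
  have zero1: "grad \<zeta> x $ i = 0" if "x \<notin> K" for x i
    by (rule grad_zero_outside[OF K that])
  have zero2: "grad (\<lambda>y. grad \<zeta> y $ i) x $ j = 0" if "x \<notin> K" for x i j
    by (rule grad_zero_outside[OF K(1) zero1 that])
  have int1: "integrable lebesgue (\<lambda>x. g x $ i * grad \<zeta> x $ i)" for i
    by (rule integrable_mult_compact_support[OF gi smooth_continuous[OF smooth_grad_component[OF \<zeta>]]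
          K(1) zero1])
  have int2: "integrable lebesgue (\<lambda>x. f x * grad (\<lambda>y. grad \<zeta> y $ i) x $ i)" for i
    by (rule integrable_mult_compact_support[OF f smooth_continuous[OF smooth_grad_component[OF
              smooth_grad_component[OF \<zeta>]]] K(1) zero2])
  have parts: "(LINT x|lebesgue. g x $ i * grad \<zeta> x $ i) =
      - (LINT x|lebesgue. f x * grad (\<lambda>y. grad \<zeta> y $ i) x $ i)" for i
  proof -
    have "test_function UNIV (\<lambda>y. grad \<zeta> y $ i)"
      using test_functionI[OF smooth_grad_component[OF \<zeta>] K(1) subset_UNIV zero1] .
    then show ?thesis
      using fg by (auto simp: weak_gradient_def)
  qed
  have eq: "(\<lambda>x. g x \<bullet> grad \<zeta> x) = (\<lambda>x. \<Sum>i\<in>UNIV. g x $ i * grad \<zeta> x $ i)"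
    by (auto simp: inner_vec_def)
  show "integrable lebesgue (\<lambda>x. g x \<bullet> grad \<zeta> x)"
    unfolding eq by (intro Bochner_Integration.integrable_sum int1)
  show "(LINT x|lebesgue. g x \<bullet> grad \<zeta> x) = - (LINT x|lebesgue. f x * laplacian \<zeta> x)"
    unfolding eq laplacian_def sum_distrib_left
    by (simp add: Bochner_Integration.integral_sum int1 int2 parts sum_negf)
qed

text \<open>A nontrivial function of x alone does not have compact support in space-time. It is
  multiplied by a cutoff \<eta> in time that equals 1 around [0,t], so \<eta> contributes no
  derivative there, and the gradient of u is moved onto \<zeta>.\<close>

lemma weak_identity_time_independent:
  fixes u ut :: "real \<Rightarrow> real^'n \<Rightarrow> real"
  assumes Du: "\<forall>t\<in>time_interval T. weak_gradient (u t) (Du t)"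
    and ut: "continuous_L1_loc T ut"
    and eq: "\<forall>t \<psi>. 0 < t \<and> ereal t < T \<and> test_function {(s, x). ereal s < T} (\<lambda>(s, x). \<psi> s x) \<longrightarrow>
           (LINT s:{0..t}|lebesgue. LINT x|lebesgue.
               - ut s x * deriv (\<lambda>r. \<psi> r x) s + Du s x \<bullet> grad (\<psi> s) x + b s * ut s x * \<psi> s x)
             + (LINT x|lebesgue. ut t x * \<psi> t x)
           = \<epsilon> * (LINT x|lebesgue. u1 x * \<psi> 0 x)
             + (LINT s:{0..t}|lebesgue. LINT x|lebesgue. \<bar>ut s x\<bar> powr p * \<psi> s x)"
    and \<zeta>: "smooth \<zeta>" and K: "compact K" "\<And>x. x \<notin> K \<Longrightarrow> \<zeta> x = 0"
    and t: "0 < t" "ereal t < T"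
  shows "(LINT s:{0..t}|lebesgue. - (LINT x|lebesgue. u s x * laplacian \<zeta> x)
              + b s * (LINT x|lebesgue. ut s x * \<zeta> x))
             + (LINT x|lebesgue. ut t x * \<zeta> x)
           = \<epsilon> * (LINT x|lebesgue. u1 x * \<zeta> x)
             + (LINT s:{0..t}|lebesgue. LINT x|lebesgue. \<bar>ut s x\<bar> powr p * \<zeta> x)"
proof -
  \<comment> \<open>The time t lies strictly below T, which leaves space for \<eta> to decay before
    T.\<close>
  obtain t2 where t2: "ereal t < ereal t2" "ereal t2 < T"
    using ereal_dense2[OF t(2)] by blast
  define \<delta> where "\<delta> = (t2 - t) / 2"
  have \<delta>: "\<delta> > 0" "t + \<delta> + \<delta> = t2"
    using t2(1) by (auto simp: \<delta>_def)
  \<comment> \<open>The plateau starts at -1 and ends at t + \<delta>, so that it is a neighbourhood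
    of the closed interval [0,t]; the time derivative of \<psi> then vanishes at both endpoints
    too.\<close>
  obtain \<eta> where \<eta>: "smooth \<eta>" "\<And>s. s \<in> {-1..t + \<delta>} \<Longrightarrow> \<eta> s = 1"
      "\<And>s. s \<notin> {-1 - \<delta>..t + \<delta> + \<delta>} \<Longrightarrow> \<eta> s = 0"
    using smooth_cutoff_exists[OF \<delta>(1), of "-1" "t + \<delta>"] by metis
  define \<psi> where "\<psi> = (\<lambda>s x. \<eta> s * \<zeta> x)"
  have "test_function {(s, x). ereal s < T} (\<lambda>(s, x). \<psi> s x)"
    unfolding \<psi>_def using t2(2) \<delta>(2)
    by (intro test_function_product[OF \<eta>(1) \<eta>(3) _ \<zeta> K]) auto
  from eq[rule_format, OF conjI[OF t(1) conjI[OF t(2) this]]]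
  have id: "(LINT s:{0..t}|lebesgue. LINT x|lebesgue.
               - ut s x * deriv (\<lambda>r. \<psi> r x) s + Du s x \<bullet> grad (\<psi> s) x + b s * ut s x * \<psi> s x)
             + (LINT x|lebesgue. ut t x * \<psi> t x)
           = \<epsilon> * (LINT x|lebesgue. u1 x * \<psi> 0 x)
             + (LINT s:{0..t}|lebesgue. LINT x|lebesgue. \<bar>ut s x\<bar> powr p * \<psi> s x)" .
  have \<psi>: "\<psi> s = \<zeta>" if "s \<in> {0..t}" for s
    using \<eta>(2)[of s] that \<delta>(1) by (auto simp: \<psi>_def)
  have deriv: "deriv (\<lambda>r. \<psi> r x) s = 0" if "s \<in> {0..t}" for s x
  proof (rule DERIV_imp_deriv)
    show "((\<lambda>r. \<psi> r x) has_field_derivative 0) (at s)"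
      by (rule has_field_derivative_transform_within_open[of "\<lambda>_. \<zeta> x" 0 s "{-1<..<t + \<delta>}"])
        (use that \<delta>(1) \<eta>(2) in \<open>auto simp: \<psi>_def\<close>)
  qed
  have 1: "(LINT s:{0..t}|lebesgue. LINT x|lebesgue.
        - ut s x * deriv (\<lambda>r. \<psi> r x) s + Du s x \<bullet> grad (\<psi> s) x + b s * ut s x * \<psi> s x) =
      (LINT s:{0..t}|lebesgue. - (LINT x|lebesgue. u s x * laplacian \<zeta> x)
              + b s * (LINT x|lebesgue. ut s x * \<zeta> x))"
  proof (rule set_lebesgue_integral_cong)
    show "\<forall>s. s \<in> {0..t} \<longrightarrow> (LINT x|lebesgue. - ut s x * deriv (\<lambda>r. \<psi> r x) s + Du s x \<bullet> grad (\<psi> s) x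
          + b s * ut s x * \<psi> s x) =
        - (LINT x|lebesgue. u s x * laplacian \<zeta> x) + b s * (LINT x|lebesgue. ut s x * \<zeta> x)"
    proof (intro allI impI)
      fix s assume s: "s \<in> {0..t}"
      have "ereal s \<le> ereal t"
        using s by simp
      also note t(2)
      finally have sT: "s \<in> time_interval T"
        using s by (simp add: time_interval_def)
      have "integrable lebesgue (\<lambda>x. ut s x * \<zeta> x)"
        using ut sT by (intro integrable_mult_compact_support[OF _ smooth_continuous[OF \<zeta>] K])
          (auto simp: continuous_L1_loc_def)
      then have "integrable lebesgue (\<lambda>x. b s * (ut s x * \<zeta> x))"
        by simp
      with weak_gradient_laplacian[OF Du[rule_format, OF sT] \<zeta> K]
      show "(LINT x|lebesgue. - ut s x * deriv (\<lambda>r. \<psi> r x) s + Du s x \<bullet> grad (\<psi> s) x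
          + b s * ut s x * \<psi> s x) =
        - (LINT x|lebesgue. u s x * laplacian \<zeta> x) + b s * (LINT x|lebesgue. ut s x * \<zeta> x)"
        by (simp add: deriv[OF s] \<psi>[OF s] mult.assoc)
    qed
  qed auto
  have 2: "(LINT s:{0..t}|lebesgue. LINT x|lebesgue. \<bar>ut s x\<bar> powr p * \<psi> s x) =
      (LINT s:{0..t}|lebesgue. LINT x|lebesgue. \<bar>ut s x\<bar> powr p * \<zeta> x)"
    by (rule set_lebesgue_integral_cong) (auto simp: \<psi>)
  show ?thesis
    using id t(1) unfolding 1 2 by (simp add: \<psi>)
qed

text \<open>The cutoff is a product of one-dimensional ones, equal to 1 on a cube that contains the
  ball. On the open ball derivatives depend only on the values there, and the exponential of a
  coordinate is an eigenfunction of the Laplacian with eigenvalue 1.\<close>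

lemma plane_wave_cutoff_exists:
  fixes i :: "'n::finite"
  assumes "\<rho> > 0"
  obtains \<zeta> :: "real^'n \<Rightarrow> real" and K where "smooth \<zeta>" "compact K" "\<And>x. x \<notin> K \<Longrightarrow> \<zeta> x = 0"
    "\<And>x. 0 \<le> \<zeta> x" "\<And>x. x \<in> ball 0 \<rho> \<Longrightarrow> \<zeta> x = exp (x $ i)"
    "\<And>x. x \<in> ball 0 \<rho> \<Longrightarrow> laplacian \<zeta> x = exp (x $ i)"
proof -
  obtain h :: "real \<Rightarrow> real" where h: "smooth h" "\<And>x. x \<in> {-\<rho>..\<rho>} \<Longrightarrow> h x = 1"
      "\<And>x. x \<notin> {-\<rho>-1..\<rho>+1} \<Longrightarrow> h x = 0" "\<And>x. 0 \<le> h x"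
    using smooth_cutoff_exists[of 1 "-\<rho>" \<rho>] by (metis zero_less_one)
  define \<zeta> :: "real^'n \<Rightarrow> real" where "\<zeta> = (\<lambda>x. exp (x $ i) * (\<Prod>j\<in>UNIV. h (x $ j)))"
  define K :: "(real^'n) set" where "K = cbox (\<chi> j. -\<rho>-1) (\<chi> j. \<rho>+1)"
  have lin: "bounded_linear (\<lambda>x::real^'n. x $ j)" for j
    by (rule bounded_linear_vec_nth)
  have smooth: "smooth \<zeta>"
    unfolding \<zeta>_def using smooth_compose_linear[OF lin h(1)]
    by (intro smooth_mult smooth_compose_linear[OF lin smooth_exp])
      (auto simp: smooth_def intro!: C_k_prod)
  have K: "compact K"
    by (simp add: K_def)
  have zero: "\<zeta> x = 0" if "x \<notin> K" for x
  proof -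
    obtain j where "x $ j \<notin> {-\<rho>-1..\<rho>+1}"
      using \<open>x \<notin> K\<close> by (auto simp: K_def mem_box_cart)
    then have "h (x $ j) = 0"
      by (rule h(3))
    then have "(\<Prod>j\<in>UNIV. h (x $ j)) = 0"
      by (intro prod_zero) auto
    then show ?thesis
      by (simp add: \<zeta>_def)
  qed
  have nonneg: "0 \<le> \<zeta> x" for x
    unfolding \<zeta>_def using h(4) by (intro mult_nonneg_nonneg prod_nonneg) auto
  have val: "\<zeta> x = exp (x $ i)" if "x \<in> ball 0 \<rho>" for x
  proof -
    have "h (x $ j) = 1" for j
      using component_le_norm_cart[of x j] that by (intro h(2)) (auto simp: abs_le_iff)
    then show ?thesis
      by (simp add: \<zeta>_def)
  qed
  \<comment> \<open>The factor c lets the same formula serve for the second derivatives, where c is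
    1 for j = i and 0 otherwise.\<close>
  have grad_exp: "grad (\<lambda>y. c * exp (y $ i)) x $ j = c * exp (x $ i) * (if j = i then 1 else 0)"
    for x :: "real^'n" and j c
  proof -
    have "((\<lambda>y::real^'n. c * exp (y $ i)) has_derivative (\<lambda>v. c * (v $ i * exp (x $ i)))) (at x)"
      by (auto intro!: derivative_eq_intros bounded_linear_imp_has_derivative[OF lin])
    from frechet_derivative_eqI[OF this] show ?thesis
      by (simp add: grad_def axis_def)
  qed
  have grad_cong: "grad f x $ j = grad g x $ j"
    if "x \<in> ball 0 \<rho>" "\<And>y. y \<in> ball 0 \<rho> \<Longrightarrow> f y = g y" for f g :: "real^'n \<Rightarrow> real" and x j
    using frechet_derivative_cong_open[OF open_ball that] by (simp add: grad_def)
  have grad1: "grad \<zeta> x $ j = (if j = i then 1 else 0) * exp (x $ i)" if "x \<in> ball 0 \<rho>" for x j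
    using grad_cong[OF that, of \<zeta> "\<lambda>y. 1 * exp (y $ i)" j] val grad_exp[of 1 x j] by simp
  have "laplacian \<zeta> x = exp (x $ i)" if "x \<in> ball 0 \<rho>" for x
  proof -
    have "grad (\<lambda>y. grad \<zeta> y $ j) x $ j = grad (\<lambda>y. (if j = i then 1 else 0) * exp (y $ i)) x $ j" for j
      by (rule grad_cong[OF that grad1])
    then have "grad (\<lambda>y. grad \<zeta> y $ j) x $ j = (if j = i then exp (x $ i) else 0)" for j
      unfolding grad_exp by simp
    then show ?thesis
      by (simp add: laplacian_def)
  qed
  then show thesis
    using that smooth K zero nonneg val by blast
qed

text \<open>The left-hand side is the tangent of a^p at a = m, so this is convexity. Young's
  inequality for a and m^{p-1} yields it with a = 0 and m = 0 included.\<close>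

lemma powr_ge_tangent:
  fixes a m p :: real
  assumes "0 \<le> a" "0 \<le> m" "1 < p"
  shows "p * m powr (p - 1) * a - (p - 1) * m powr p \<le> a powr p"
proof -
  have "a * m powr (p - 1) \<le> a powr p / p + (m powr (p - 1)) powr (p / (p - 1)) / (p / (p - 1))"
    using assms by (intro Youngs_inequality) (auto simp: field_simps)
  also have "(m powr (p - 1)) powr (p / (p - 1)) = m powr p"
    using assms by (simp add: powr_powr)
  finally have "p * (a * m powr (p - 1)) \<le> p * (a powr p / p + m powr p / (p / (p - 1)))"
    using assms by (intro mult_left_mono) auto
  also have "\<dots> = a powr p + (p - 1) * m powr p"
    using assms by (simp add: distrib_left)
  finally show ?thesis
    by (simp add: mult_ac)
qed

text \<open>Jensen's inequality for the weight \<zeta> on S, obtained by integrating the tangent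
  inequality at a suitable m. Only an upper bound W for the mass of the weight is used.
  Integrability of |f|^p \<zeta> is essential: the Bochner integral of a nonintegrable function is
  0, and the inequality could fail.\<close>

lemma powr_integral_le:
  fixes f \<zeta> :: "'a::euclidean_space \<Rightarrow> real"
  assumes p: "p > 1" and f: "L1_loc UNIV f" and \<zeta>: "continuous_on UNIV \<zeta>" "\<And>x. 0 \<le> \<zeta> x"
    and K: "compact K" "\<And>x. x \<notin> K \<Longrightarrow> \<zeta> x = 0"
    and S: "S \<in> sets lebesgue" "AE x in lebesgue. x \<notin> S \<longrightarrow> f x = 0"
    and int: "integrable lebesgue (\<lambda>x. \<bar>f x\<bar> powr p * \<zeta> x)"
    and W: "W > 0" "(LINT x|lebesgue. indicator S x * \<zeta> x) \<le> W"
  shows "\<bar>LINT x|lebesgue. f x * \<zeta> x\<bar> powr p * W powr (1 - p) \<le> (LINT x|lebesgue. \<bar>f x\<bar> powr p * \<zeta> x)"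
proof -
  define a where "a = \<bar>LINT x|lebesgue. f x * \<zeta> x\<bar>"
  \<comment> \<open>This value of m maximizes p m^{p-1} a - (p-1) m^p W; the maximum is m^p W = a^p
    W^{1-p}.\<close>
  define m where "m = a / W"
  have m: "m \<ge> 0"
    using W by (simp add: m_def a_def)
  have "integrable lebesgue (\<lambda>x. \<bar>f x * \<zeta> x\<bar>)"
    using integrable_mult_compact_support[OF f \<zeta>(1) K] by simp
  then have i1: "integrable lebesgue (\<lambda>x. \<bar>f x\<bar> * \<zeta> x)"
    using \<zeta>(2) by (simp add: abs_mult)
  have "integrable lebesgue (\<lambda>x. 1 * \<zeta> x)"
    by (rule integrable_mult_compact_support[OF _ \<zeta>(1) K])
      (auto simp: L1_loc_def intro!: absolutely_integrable_on_const lmeasurable_compact)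
  from integrable_mult_indicator[OF S(1) this]
  have i2: "integrable lebesgue (\<lambda>x. indicator S x * \<zeta> x)"
    by simp
  have "a \<le> (LINT x|lebesgue. \<bar>f x\<bar> * \<zeta> x)"
    using integral_abs_bound[of lebesgue "\<lambda>x. f x * \<zeta> x"] \<zeta>(2) by (simp add: a_def abs_mult)
  then have "p * m powr (p - 1) * a - (p - 1) * m powr p * W \<le>
      p * m powr (p - 1) * (LINT x|lebesgue. \<bar>f x\<bar> * \<zeta> x) -
      (p - 1) * m powr p * (LINT x|lebesgue. indicator S x * \<zeta> x)"
    using p W(2) by (intro diff_mono mult_left_mono) auto
  also have "\<dots> = (LINT x|lebesgue. p * m powr (p - 1) * (\<bar>f x\<bar> * \<zeta> x) -
      (p - 1) * m powr p * (indicator S x * \<zeta> x))"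
    using i1 i2 by simp
  also have "\<dots> \<le> (LINT x|lebesgue. \<bar>f x\<bar> powr p * \<zeta> x)"
  proof (rule integral_mono_AE)
    show "integrable lebesgue (\<lambda>x. p * m powr (p - 1) * (\<bar>f x\<bar> * \<zeta> x) -
        (p - 1) * m powr p * (indicator S x * \<zeta> x))"
      using i1 i2 by simp
    show "AE x in lebesgue. p * m powr (p - 1) * (\<bar>f x\<bar> * \<zeta> x) -
        (p - 1) * m powr p * (indicator S x * \<zeta> x) \<le> \<bar>f x\<bar> powr p * \<zeta> x"
      using S(2)
    proof eventually_elim
      case (elim x)
      show ?case
      proof (cases "x \<in> S")
        case True
        have "(p * m powr (p - 1) * \<bar>f x\<bar> - (p - 1) * m powr p) * \<zeta> x \<le> \<bar>f x\<bar> powr p * \<zeta> x"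
          using p m \<zeta>(2)[of x] by (intro mult_right_mono powr_ge_tangent) auto
        then show ?thesis
          using True by (simp add: algebra_simps)
      qed (use elim in auto)
    qed
  qed (rule int)
  finally have le: "p * m powr (p - 1) * a - (p - 1) * m powr p * W \<le>
      (LINT x|lebesgue. \<bar>f x\<bar> powr p * \<zeta> x)" .
  show ?thesis
  proof (cases "a = 0")
    case True
    moreover have "0 \<le> (LINT x|lebesgue. \<bar>f x\<bar> powr p * \<zeta> x)"
      by (rule integral_nonneg_AE) (simp add: \<zeta>(2))
    ultimately show ?thesis
      unfolding a_def by simp
  next
    case False
    then have a: "a > 0"
      by (simp add: a_def)
    then have "m powr (p - 1) * a = m powr p * W"
      using W(1) by (simp add: m_def powr_diff)
    then have "p * m powr (p - 1) * a - (p - 1) * m powr p * W = m powr p * W"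
      by (simp add: algebra_simps)
    also have "\<dots> = a powr p * W powr (1 - p)"
      using a W(1) by (simp add: m_def powr_divide powr_diff)
    finally show ?thesis
      using le by (simp add: a_def)
  qed
qed

lemma integral_plane_wave_cball:
  fixes \<zeta> :: "real^'n \<Rightarrow> real" and i :: 'n
  assumes r: "0 < r" "r < \<rho>" and \<zeta>: "continuous_on UNIV \<zeta>"
    and eq: "\<And>x. x \<in> ball 0 \<rho> \<Longrightarrow> \<zeta> x = exp (x $ i)"
  shows "(LINT x|lebesgue. indicator (cball 0 r) x * \<zeta> x) \<le>
    2 * exp r * (4 * pi * r) powr ((real CARD('n) - 1) / 2)"
proof -
  have eq': "indicator (cball 0 r) x * \<zeta> x = indicator (cball 0 r) x * exp (x \<bullet> axis i (1::real))" for x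
    using eq[of x] r by (auto simp: indicator_def inner_axis)
  have "(LINT x|lebesgue. indicator (cball 0 r) x * \<zeta> x) =
      enn2real (\<integral>\<^sup>+x. ennreal (indicator (cball 0 r) x * \<zeta> x) \<partial>lebesgue)"
  proof (rule integral_eq_nn_integral)
    show "(\<lambda>x. indicator (cball 0 r) x * \<zeta> x) \<in> borel_measurable lebesgue"
      by (intro borel_measurable_times borel_measurable_indicator
          continuous_borel_measurable_lebesgue \<zeta>) auto
    show "AE x in lebesgue. 0 \<le> indicator (cball 0 r) x * \<zeta> x"
      unfolding eq' by (intro AE_I2) simp
  qed
  also have "(\<integral>\<^sup>+x. ennreal (indicator (cball 0 r) x * \<zeta> x) \<partial>lebesgue) =
      (\<integral>\<^sup>+x. ennreal (exp (x \<bullet> axis i (1::real))) * indicator (cball 0 r) x \<partial>lborel)"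
    unfolding nn_integral_completion eq'
    by (intro nn_integral_cong) (auto simp: indicator_def)
  also have "enn2real \<dots> \<le> 2 * exp r * (4 * pi * r) powr ((real CARD('n) - 1) / 2)"
    using nn_integral_exp_cball[of "axis i 1 :: real^'n" r] r by (intro enn2real_leI) auto
  finally show ?thesis .
qed

text \<open>Serves to exchange a cutoff for the function that it cuts off. Outside S nothing is
  known about g, but f * g agrees almost everywhere with the integrable f * \<zeta>, which also
  makes it measurable.\<close>

lemma integral_eq_on_support:
  fixes f \<zeta> g :: "'a::euclidean_space \<Rightarrow> real"
  assumes "integrable lebesgue (\<lambda>x. f x * \<zeta> x)" "AE x in lebesgue. x \<notin> S \<longrightarrow> f x = 0"
    and "\<And>x. x \<in> S \<Longrightarrow> \<zeta> x = g x"
  shows "(LINT x|lebesgue. f x * \<zeta> x) = (LINT x|lebesgue. f x * g x)"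
proof -
  have ae: "AE x in lebesgue. f x * \<zeta> x = f x * g x"
    using assms(2) by eventually_elim (use assms(3) in force)
  show ?thesis
    by (rule integral_cong_AE[OF _ borel_measurable_completion_cong_AE[OF _ ae] ae])
      (use assms(1) in auto)
qed

text \<open>Pairing the solution with the cut-off plane wave yields a damped system on [0,t] to
  which \<open>damped_system_blowup\<close> applies with \<kappa> = D^{1-p} and initial constant
  \<epsilon> c. The constant c depends on the data only, which makes the dependence on \<epsilon>
  explicit.\<close>

lemma weak_solution_time_bound:
  fixes u0 u1 :: "real^'n \<Rightarrow> real" and i :: 'n
  assumes sol: "weak_solution b p \<epsilon> u0 u1 R T u"
    and p: "p > 1" and \<epsilon>: "\<epsilon> > 0" and R: "R > 0"
    and u0: "L1_loc UNIV u0" and u1: "L1_loc UNIV u1"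
    and supp0: "ess_support u0 \<subseteq> cball 0 R" and supp1: "ess_support u1 \<subseteq> cball 0 R"
    and b: "continuous_on {0..t} b" "\<And>s. s \<in> {0..t} \<Longrightarrow> 0 \<le> b s"
    and \<beta>: "\<And>s. s \<in> {0..t} \<Longrightarrow> (\<beta> has_real_derivative b s * \<beta> s) (at s within {0..t})"
    and \<beta>0: "\<beta> 0 = 1" "\<And>s. s \<in> {0..t} \<Longrightarrow> 0 < \<beta> s" "\<And>s. s \<in> {0..t} \<Longrightarrow> \<beta> s \<le> \<beta> t"
    and t: "0 < t" "ereal t < T"
    and c: "0 < c" "c \<le> (LINT x|lebesgue. u1 x * exp (x $ i))"
      "2 * c \<le> (LINT x|lebesgue. u0 x * exp (x $ i)) + (LINT x|lebesgue. u1 x * exp (x $ i))"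
      "0 \<le> (LINT x|lebesgue. u0 x * exp (x $ i))"
  shows "(p - 1) / 2 * (2 * exp R * (4 * pi * (R + t)) powr ((real CARD('n) - 1) / 2)) powr (1 - p)
    * t * \<beta> t powr (1 - p) \<le> (\<epsilon> * c) powr (1 - p)"
proof -
  from sol obtain ut Du where
    cu: "continuous_L1_loc T u" and Du: "\<forall>t\<in>time_interval T. weak_gradient (u t) (Du t)"
    and d: "derivative_L1_loc T u ut" and cut: "continuous_L1_loc T ut"
    and Lp: "L1_loc (time_interval T \<times> UNIV) (\<lambda>(s, x). \<bar>ut s x\<bar> powr p)"
    and ess: "\<forall>t>0. ereal t < T \<longrightarrow> ess_support (u t) \<subseteq> cball 0 (R + t)"
    and init: "AE x in lebesgue. u 0 x = \<epsilon> * u0 x"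
    and eq: "\<forall>t \<psi>. 0 < t \<and> ereal t < T \<and> test_function {(s, x). ereal s < T} (\<lambda>(s, x). \<psi> s x) \<longrightarrow>
           (LINT s:{0..t}|lebesgue. LINT x|lebesgue.
               - ut s x * deriv (\<lambda>r. \<psi> r x) s + Du s x \<bullet> grad (\<psi> s) x + b s * ut s x * \<psi> s x)
             + (LINT x|lebesgue. ut t x * \<psi> t x)
           = \<epsilon> * (LINT x|lebesgue. u1 x * \<psi> 0 x)
             + (LINT s:{0..t}|lebesgue. LINT x|lebesgue. \<bar>ut s x\<bar> powr p * \<psi> s x)"
    unfolding weak_solution_def by blast
  have sub: "{0..t} \<subseteq> time_interval T"
  proof
    fix s assume s: "s \<in> {0..t}"
    then have "ereal s \<le> ereal t"
      by simp
    also note t(2)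
    finally show "s \<in> time_interval T"
      using s by (simp add: time_interval_def)
  qed
  have supp: "AE x in lebesgue. x \<notin> cball 0 (R + s) \<longrightarrow> u s x = 0" if "s \<in> time_interval T" for s
  proof (cases "s = 0")
    case True
    show ?thesis
      using init AE_zero_if_ess_support_subset[OF supp0]
      by eventually_elim (simp add: True)
  next
    case False
    then show ?thesis
      using that ess by (intro AE_zero_if_ess_support_subset) (auto simp: time_interval_def)
  qed
  \<comment> \<open>The radius R + t + 1 puts every closed ball of radius R + s with s \<le> t
    inside the open ball on which \<zeta> and its Laplacian are the exponential. What \<zeta> does
    further out never meets u or ut.\<close>
  obtain \<zeta> :: "real^'n \<Rightarrow> real" and K where \<zeta>: "smooth \<zeta>" and K: "compact K" "\<And>x. x \<notin> K \<Longrightarrow> \<zeta> x = 0"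
    and \<zeta>_nonneg: "\<And>x. 0 \<le> \<zeta> x" and \<zeta>_eq: "\<And>x. x \<in> ball 0 (R + t + 1) \<Longrightarrow> \<zeta> x = exp (x $ i)"
    and lap: "\<And>x. x \<in> ball 0 (R + t + 1) \<Longrightarrow> laplacian \<zeta> x = exp (x $ i)"
    using plane_wave_cutoff_exists[of "R + t + 1" i] R t(1) by auto
  note c\<zeta> = smooth_continuous[OF \<zeta>, of UNIV]
  have cball: "x \<in> ball 0 (R + t + 1)" if "x \<in> cball 0 (R + s)" "s \<in> {0..t}" for x :: "real^'n" and s
    using that by auto
  define A where "A = (\<lambda>s. LINT x|lebesgue. ut s x * \<zeta> x)"
  define B where "B = (\<lambda>s. LINT x|lebesgue. u s x * \<zeta> x)"
  define N where "N = (\<lambda>s. LINT x|lebesgue. \<bar>ut s x\<bar> powr p * \<zeta> x)"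
  have L1: "L1_loc UNIV (u s)" "L1_loc UNIV (ut s)" if "s \<in> {0..t}" for s
    using cu cut that sub by (auto simp: continuous_L1_loc_def)
  have cA: "continuous_on {0..t} A"
    unfolding A_def by (rule continuous_on_subset[OF continuous_on_pairing[OF cut c\<zeta> K] sub])
  have dB: "(B has_real_derivative A s) (at s within {0..t})" if "s \<in> {0..t}" for s
    unfolding A_def B_def
    using has_field_derivative_subset[OF has_derivative_pairing[OF cu cut d c\<zeta> K] sub] that sub by blast
  have cB: "continuous_on {0..t} B"
    by (rule DERIV_continuous_on[OF dB])
  have lapB: "(LINT x|lebesgue. u s x * laplacian \<zeta> x) = B s" if s: "s \<in> {0..t}" for s
    unfolding B_def
  proof (rule integral_eq_on_support[OF integrable_mult_compact_support[OF L1(1)[OF s]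
          continuous_laplacian[OF \<zeta>] K(1) laplacian_zero_outside[OF K]] supp])
    show "laplacian \<zeta> x = \<zeta> x" if "x \<in> cball 0 (R + s)" for x
      using lap \<zeta>_eq cball[OF that s] by simp
  qed (use s sub in auto)
  \<comment> \<open>Restricting to the compact set [0,t] \<times> K turns local integrability on
    space-time into integrability, so that Fubini shows N to be measurable and integrable in
    time.\<close>
  define G where "G = (\<lambda>(s, x). indicator ({0..t} \<times> K) (s, x) * (\<bar>ut s x\<bar> powr p * \<zeta> x))"
  have G_int: "integrable lebesgue G"
  proof -
    have "set_integrable lebesgue ({0..t} \<times> K) (\<lambda>z. (case z of (s, x) \<Rightarrow> \<bar>ut s x\<bar> powr p) * \<zeta> (snd z))"
    proof (rule set_integrable_mult_continuous)
      show "compact ({0..t} \<times> K)"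
        using K(1) by (intro compact_Times) auto
      then show "set_integrable lebesgue ({0..t} \<times> K) (\<lambda>(s, x). \<bar>ut s x\<bar> powr p)"
        using Lp sub by (auto simp: L1_loc_def)
      show "continuous_on UNIV (\<lambda>z::real \<times> (real^'n). \<zeta> (snd z))"
        by (intro continuous_on_compose2[OF c\<zeta>] continuous_intros) auto
    qed
    then show ?thesis
      by (simp add: set_integrable_def G_def case_prod_beta')
  qed
  have G: "(\<lambda>x. G (s, x)) = (\<lambda>x. \<bar>ut s x\<bar> powr p * \<zeta> x)" if "s \<in> {0..t}" for s
  proof
    show "G (s, x) = \<bar>ut s x\<bar> powr p * \<zeta> x" for x
      using that K(2)[of x] by (cases "x \<in> K") (auto simp: G_def)
  qed
  have G0: "G (s, x) = 0" if "s \<notin> {0..t}" for s x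
    using that by (auto simp: G_def)
  have N_int: "set_integrable lebesgue {0..t} N"
  proof -
    have "(\<lambda>s. LINT x|lebesgue. G (s, x)) = (\<lambda>s. indicator {0..t} s *\<^sub>R N s)"
    proof
      show "(LINT x|lebesgue. G (s, x)) = indicator {0..t} s *\<^sub>R N s" for s
        using G[of s] G0[of s] by (cases "s \<in> {0..t}") (auto simp: N_def)
    qed
    then show ?thesis
      using lebesgue_Fubini(2)[OF G_int] by (simp add: set_integrable_def)
  qed
  have sections: "AE s in lebesgue. s \<in> {0..t} \<longrightarrow> integrable lebesgue (\<lambda>x. \<bar>ut s x\<bar> powr p * \<zeta> x)"
    using lebesgue_Fubini(1)[OF G_int] by eventually_elim (auto simp: G)
  \<comment> \<open>D e^s bounds the mass of the plane wave on the ball of radius R + s for every s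
    \<le> t. The radius in the algebraic factor is frozen at R + t to keep D constant in
    time.\<close>
  define D where "D = 2 * exp R * (4 * pi * (R + t)) powr ((real CARD('n) - 1) / 2)"
  define g where "g = (\<lambda>s. D powr (1 - p) * exp (- (p - 1) * s) * \<bar>A s\<bar> powr p)"
  have D: "D > 0"
    using R t(1) by (simp add: D_def)
  \<comment> \<open>Fubini gives integrability in x only for almost every s; at the other times N s
    is the default value 0. A comparison almost everywhere suffices, as only integrals over time
    intervals are compared.\<close>
  have g_le: "AE s in lebesgue. s \<in> {0..t} \<longrightarrow> g s \<le> N s"
    using sections
  proof eventually_elim
    case (elim s)
    show ?case
    proof
      assume s: "s \<in> {0..t}"
      have "(LINT x|lebesgue. indicator (cball 0 (R + s)) x * \<zeta> x) \<le>
          2 * exp (R + s) * (4 * pi * (R + s)) powr ((real CARD('n) - 1) / 2)"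
        using R s \<zeta>_eq by (intro integral_plane_wave_cball[where \<rho>="R + t + 1" and i=i] c\<zeta>) auto
      also have "\<dots> \<le> 2 * exp (R + s) * (4 * pi * (R + t)) powr ((real CARD('n) - 1) / 2)"
        using R s by (intro mult_left_mono powr_mono2) (auto simp: Suc_leI)
      also have "\<dots> = D * exp s"
        by (simp add: D_def exp_add)
      finally have mass: "(LINT x|lebesgue. indicator (cball 0 (R + s)) x * \<zeta> x) \<le> D * exp s" .
      have "\<bar>A s\<bar> powr p * (D * exp s) powr (1 - p) \<le> N s"
        unfolding A_def N_def
      proof (rule powr_integral_le[OF p L1(2)[OF s] c\<zeta> \<zeta>_nonneg K])
        show "AE x in lebesgue. x \<notin> cball 0 (R + s) \<longrightarrow> ut s x = 0"
          using s sub by (intro derivative_vanishes_outside_cone[OF cut d supp]) auto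
      qed (use elim s D mass in auto)
      moreover have "(D * exp s) powr (1 - p) = D powr (1 - p) * exp (- (p - 1) * s)"
        using D by (simp add: powr_mult powr_def[of "exp s"] algebra_simps)
      ultimately show "g s \<le> N s"
        by (simp add: g_def mult_ac)
    qed
  qed
  have cg: "continuous_on {0..t} g"
    unfolding g_def using p by (intro continuous_intros cA continuous_on_powr') auto
  define F where "F = (\<lambda>s. - B s + b s * A s)"
  have cF: "continuous_on {0..t} F"
    unfolding F_def by (intro continuous_intros cA cB b)
  have abs_int: "f absolutely_integrable_on {r..s}" if "continuous_on {0..t} f" "0 \<le> r" "s \<le> t"
    for f :: "real \<Rightarrow> real" and r s
    using that by (intro absolutely_integrable_continuous_real continuous_on_subset[OF that(1)]) auto
  have N_sub: "set_integrable lebesgue {r..s} N" if "0 \<le> r" "s \<le> t" for r s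
    by (rule set_integrable_subset[OF N_int]) (use that in auto)
  define a0 where "a0 = (LINT x|lebesgue. u0 x * exp (x $ i))"
  define a1 where "a1 = (LINT x|lebesgue. u1 x * exp (x $ i))"
  have data: "(LINT x|lebesgue. f x * \<zeta> x) = (LINT x|lebesgue. f x * exp (x $ i))"
    if "L1_loc UNIV f" "ess_support f \<subseteq> cball 0 R" for f
    by (rule integral_eq_on_support[OF integrable_mult_compact_support[OF that(1) c\<zeta> K]
          AE_zero_if_ess_support_subset[OF that(2)]])
      (use \<zeta>_eq t(1) in auto)
  have id: "A s = \<epsilon> * a1 + integral {0..s} N - integral {0..s} F" if s: "0 < s" "s \<le> t" for s
  proof -
    have "ereal s < T"
      using sub s by (auto simp: time_interval_def subset_iff)
    note id1 = weak_identity_time_independent[OF Du cut eq \<zeta> K s(1) this]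
    have "(LINT r:{0..s}|lebesgue. - (LINT x|lebesgue. u r x * laplacian \<zeta> x)
              + b r * (LINT x|lebesgue. ut r x * \<zeta> x)) = (LINT r:{0..s}|lebesgue. F r)"
      using s lapB by (intro set_lebesgue_integral_cong) (auto simp: F_def A_def)
    also have "\<dots> = integral {0..s} F"
      using s by (intro set_lebesgue_integral_eq_integral abs_int cF) auto
    finally have 1: "(LINT r:{0..s}|lebesgue. - (LINT x|lebesgue. u r x * laplacian \<zeta> x)
              + b r * (LINT x|lebesgue. ut r x * \<zeta> x)) = integral {0..s} F" .
    have 2: "(LINT r:{0..s}|lebesgue. N r) = integral {0..s} N"
      using s by (intro set_lebesgue_integral_eq_integral N_sub) auto
    show ?thesis
      using id1 unfolding 1 N_def[symmetric] 2 data[OF u1 supp1] a1_def by (simp add: A_def)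
  qed
  have N_HK: "N integrable_on {0..t}"
    using set_lebesgue_integral_eq_integral(1)[OF N_int] .
  have F_HK: "F integrable_on {0..t}"
    using cF by (rule integrable_continuous_real)
  \<comment> \<open>The definition of a weak solution does not prescribe ut at time 0, and the
    identity for A is available only for s > 0. The initial velocity is recovered by letting s tend
    to 0, all terms being continuous.\<close>
  have A0: "A 0 = \<epsilon> * a1"
  proof -
    define h where "h = (\<lambda>s. A s - (\<epsilon> * a1 + integral {0..s} N - integral {0..s} F))"
    have "continuous_on {0..t} h"
      unfolding h_def
      by (intro continuous_intros cA indefinite_integral_continuous_1 N_HK F_HK)
    then have "(h \<longlongrightarrow> h 0) (at 0 within {0..t})"
      using t(1) by (simp add: continuous_on_def)
    moreover have "at 0 within {0..t} \<noteq> bot"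
      using t(1) by (simp add: trivial_limit_within islimpt_Icc)
    moreover have "(h \<longlongrightarrow> 0) (at 0 within {0..t})"
    proof (rule Lim_transform_eventually[of "\<lambda>_. 0"])
      show "\<forall>\<^sub>F s in at 0 within {0..t}. 0 = h s"
        unfolding eventually_at_filter
        by (rule always_eventually) (auto simp: h_def id)
    qed simp
    ultimately have "h 0 = 0"
      by (metis tendsto_unique)
    then show ?thesis
      by (simp add: h_def)
  qed
  have idA: "A s = \<epsilon> * a1 + integral {0..s} N - integral {0..s} F" if "s \<in> {0..t}" for s
    using that id[of s] A0 by (cases "s = 0") auto
  have "integrated_deriv_ge t A (\<lambda>s. B s - b s * A s + g s)"
    unfolding integrated_deriv_ge_def
  proof (intro conjI allI impI)
    fix r s assume rs: "0 \<le> r \<and> r \<le> s \<and> s \<le> t"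
    have comb: "integral {0..s} f - integral {0..r} f = integral {r..s} f" if "f integrable_on {0..t}"
      for f :: "real \<Rightarrow> real"
    proof -
      have "f integrable_on {0..s}"
        using rs by (intro integrable_subinterval_real[OF that]) auto
      then show ?thesis
        using Henstock_Kurzweil_Integration.integral_combine[of 0 r s f] rs by simp
    qed
    have "integral {r..s} (\<lambda>s. B s - b s * A s + g s) = integral {r..s} (\<lambda>s. g s - F s)"
      by (simp add: F_def algebra_simps)
    also have "\<dots> = integral {r..s} g - integral {r..s} F"
      using rs by (intro integral_diff set_lebesgue_integral_eq_integral(1) abs_int cg cF) auto
    also have "integral {r..s} g = (LINT x:{r..s}|lebesgue. g x)"
      using rs by (intro set_lebesgue_integral_eq_integral(2)[symmetric] abs_int cg) auto
    also have "\<dots> \<le> (LINT x:{r..s}|lebesgue. N x)"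
    proof (rule set_integral_mono_AE)
      show "AE x\<in>{r..s} in lebesgue. g x \<le> N x"
        using g_le by eventually_elim (use rs in auto)
    qed (use rs in \<open>auto intro!: abs_int cg N_sub\<close>)
    also have "\<dots> = integral {r..s} N"
      using rs by (intro set_lebesgue_integral_eq_integral N_sub) auto
    also have "\<dots> - integral {r..s} F = A s - A r"
      using rs comb[OF N_HK] comb[OF F_HK] by (simp add: idA)
    finally show "integral {r..s} (\<lambda>s. B s - b s * A s + g s) \<le> A s - A r"
      by simp
  qed (intro continuous_intros cA cB cg b(1))+
  moreover have "B 0 = \<epsilon> * a0"
  proof -
    have ae: "AE x in lebesgue. u 0 x * \<zeta> x = \<epsilon> * u0 x * \<zeta> x"
      using init by eventually_elim simp
    have i0: "integrable lebesgue (\<lambda>x. u 0 x * \<zeta> x)"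
      using t(1) by (intro integrable_mult_compact_support[OF L1(1) c\<zeta> K]) auto
    have "B 0 = (LINT x|lebesgue. \<epsilon> * u0 x * \<zeta> x)"
      unfolding B_def using i0
      by (intro integral_cong_AE[OF _ borel_measurable_completion_cong_AE[OF _ ae] ae]) auto
    then show ?thesis
      by (simp add: data[OF u0 supp0] a0_def mult.assoc)
  qed
  moreover have "\<epsilon> * (2 * c) \<le> \<epsilon> * (a0 + a1)" "\<epsilon> * c \<le> \<epsilon> * a1" "0 \<le> \<epsilon> * a0"
    using c \<epsilon> by (auto intro!: mult_left_mono simp: a0_def a1_def)
  \<comment> \<open>All conditions on the initial values are homogeneous of degree one, so the
    constant of the damped system is \<epsilon> * c.\<close>
  ultimately have "(p - 1) / 2 * D powr (1 - p) * t * \<beta> t powr (1 - p) \<le> (\<epsilon> * c) powr (1 - p)"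
    using p t(1) c(1) \<epsilon>
    by (intro damped_system_blowup[where A=A and B=B and b=b] dB b \<beta> \<beta>0)
      (auto simp: g_def A0 algebra_simps)
  then show ?thesis
    by (simp add: D_def)
qed

subsection \<open>Iterated logarithms and the damping weight\<close>

lemma iter_e_Suc: "iter_e (Suc k) = exp (iter_e k)"
  by (simp add: iter_e_def)

lemma iter_e_ge_1: "iter_e k \<ge> 1"
  by (induction k) (auto simp: iter_e_Suc iter_e_def[of 0] intro: order_trans)

lemma iter_ln_0 [simp]: "iter_ln 0 r = r"
  by (simp add: iter_ln_def)

lemma iter_ln_Suc: "iter_ln (Suc j) r = ln (iter_ln j r)"
  by (simp add: iter_ln_def)

text \<open>Each logarithm strips one exponential from the lower bound. Hence up to index k all
  iterated logarithms stay at least 1, and every further \<open>ln\<close> is taken inside its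
  domain.\<close>

lemma iter_ln_ge:
  assumes "r \<ge> iter_e k"
  shows "j \<le> k \<Longrightarrow> iter_ln j r \<ge> iter_e (k - j)"
proof (induction j)
  case (Suc j)
  then have "k - j = Suc (k - Suc j)"
    by simp
  then have "exp (iter_e (k - Suc j)) \<le> iter_ln j r"
    using Suc by (simp add: iter_e_Suc)
  then show ?case
    unfolding iter_ln_Suc by (metis exp_gt_zero less_le_trans ln_exp ln_le_cancel_iff)
qed (use assms in simp)

lemma iter_ln_ge_1: "r \<ge> iter_e k \<Longrightarrow> j \<le> k \<Longrightarrow> iter_ln j r \<ge> 1"
  using iter_ln_ge[of k r j] iter_e_ge_1[of "k - j"] by linarith

lemma iter_ln_mono:
  assumes "r \<ge> iter_e k" "r \<le> s"
  shows "j \<le> k \<Longrightarrow> iter_ln j r \<le> iter_ln j s"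
proof (induction j)
  case (Suc j)
  then show ?case
    using iter_ln_ge_1[of k r j] iter_ln_ge_1[of k s j] assms by (simp add: iter_ln_Suc)
qed (use assms in simp)

lemma iter_ln_le_ln:
  assumes "r \<ge> iter_e k" "j < k"
  shows "iter_ln (Suc j) r \<le> ln r"
  using assms(2)
proof (induction j)
  case (Suc j)
  have "iter_ln (Suc (Suc j)) r \<le> iter_ln (Suc j) r"
    using iter_ln_ge_1[OF assms(1), of "Suc j"] Suc.prems ln_le_minus_one[of "iter_ln (Suc j) r"]
    by (simp add: iter_ln_Suc[of "Suc j"])
  then show ?case
    using Suc by simp
qed (simp add: iter_ln_Suc)

lemma iter_ln_iter_e: "iter_ln k (iter_e k) = 1"
proof -
  have "j \<le> k \<Longrightarrow> iter_ln j (iter_e k) = iter_e (k - j)" for j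
  proof (induction j)
    case (Suc j)
    then have "k - j = Suc (k - Suc j)"
      by simp
    with Suc show ?case
      by (simp add: iter_ln_Suc iter_e_Suc)
  qed simp
  from this[of k] show ?thesis
    by (simp add: iter_e_def)
qed

lemma iter_ln_has_derivative:
  assumes "r \<ge> iter_e k"
  shows "j \<le> k \<Longrightarrow> (iter_ln j has_real_derivative 1 / (\<Prod>i<j. iter_ln i r)) (at r)"
proof (induction j)
  case 0
  have "iter_ln 0 = (\<lambda>x. x)"
    by auto
  then show ?case
    by simp
next
  case (Suc j)
  have "iter_ln j r > 0"
    using iter_ln_ge_1[OF assms, of j] Suc.prems by simp
  then have "((\<lambda>r. ln (iter_ln j r)) has_real_derivative
      1 / (\<Prod>i<j. iter_ln i r) * (1 / iter_ln j r)) (at r)"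
    using Suc by (auto intro!: derivative_eq_intros)
  moreover have "iter_ln (Suc j) = (\<lambda>r. ln (iter_ln j r))"
    by (auto simp: iter_ln_Suc)
  ultimately show ?case
    by simp
qed

text \<open>In closed form this is exp of the integral of the damping coefficient over [0,t]; the
  shift by \<open>iter_e k\<close> normalizes it to 1 at t = 0.\<close>

definition damping_weight :: "real \<Rightarrow> nat \<Rightarrow> real \<Rightarrow> real" where
  "damping_weight \<mu> k t = iter_ln k (iter_e k + t) powr \<mu>"

lemma damping_eq: "damping \<mu> k t = \<mu> / ((\<Prod>i<k. iter_ln i (iter_e k + t)) * iter_ln k (iter_e k + t))"
proof -
  \<comment> \<open>The factor \<open>iter_e k + t\<close> is the iterated logarithm of index 0, so
    the denominator is the product over all i \<le> k. Splitting off i = k leaves the denominator of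
    the derivative of \<open>iter_ln k\<close>.\<close>
  have "(iter_e k + t) * (\<Prod>j=1..k. iter_ln j (iter_e k + t)) = (\<Prod>i\<le>k. iter_ln i (iter_e k + t))"
    by (simp add: atMost_atLeast0 prod.atLeast_Suc_atMost)
  also have "\<dots> = (\<Prod>i<k. iter_ln i (iter_e k + t)) * iter_ln k (iter_e k + t)"
    by (simp add: lessThan_Suc_atMost[symmetric])
  finally show ?thesis
    by (simp add: damping_def)
qed

lemma damping_weight_has_derivative:
  assumes "t \<ge> 0"
  shows "(damping_weight \<mu> k has_real_derivative damping \<mu> k t * damping_weight \<mu> k t) (at t)"
proof -
  have pos: "iter_ln k (iter_e k + t) > 0"
    using iter_ln_ge_1[of k "iter_e k + t" k] assms by simp
  have "((\<lambda>t. iter_ln k (iter_e k + t)) has_real_derivative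
      1 / (\<Prod>i<k. iter_ln i (iter_e k + t)) * 1) (at t)"
    using assms by (intro DERIV_chain2[OF iter_ln_has_derivative[of k]])
      (auto intro!: derivative_eq_intros)
  from DERIV_fun_powr[OF this pos, of \<mu>] pos show ?thesis
    unfolding damping_weight_def[abs_def] damping_eq by (simp add: powr_diff mult_ac)
qed

lemma damping_weight_ge_1: "\<mu> > 0 \<Longrightarrow> t \<ge> 0 \<Longrightarrow> damping_weight \<mu> k t \<ge> 1"
  unfolding damping_weight_def using iter_ln_ge_1[of k "iter_e k + t" k]
  by (intro ge_one_powr_ge_zero) auto

lemma damping_weight_mono:
  "\<mu> > 0 \<Longrightarrow> 0 \<le> s \<Longrightarrow> s \<le> t \<Longrightarrow> damping_weight \<mu> k s \<le> damping_weight \<mu> k t"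
  unfolding damping_weight_def using iter_ln_ge_1[of k "iter_e k + s" k]
  by (intro powr_mono2 iter_ln_mono[of k]) auto

lemma damping_weight_0: "damping_weight \<mu> k 0 = 1"
  by (simp add: damping_weight_def iter_ln_iter_e)

lemma damping_nonneg:
  assumes "\<mu> > 0" "t \<ge> 0"
  shows "damping \<mu> k t \<ge> 0"
proof -
  have "0 \<le> iter_ln i (iter_e k + t)" if "i \<le> k" for i
    using iter_ln_ge_1[OF _ that, of "iter_e k + t"] assms(2) by simp
  then show ?thesis
    unfolding damping_eq using assms(1)
    by (intro divide_nonneg_nonneg mult_nonneg_nonneg prod_nonneg) auto
qed

lemma continuous_on_damping: "continuous_on {0..t} (damping \<mu> k)"
proof -
  have c: "continuous_on {0..t} (\<lambda>s. iter_ln i (iter_e k + s))" if "i \<le> k" for i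
  proof (rule DERIV_continuous_on)
    fix s assume "s \<in> {0..t}"
    then have "((\<lambda>s. iter_ln i (iter_e k + s)) has_real_derivative
        1 / (\<Prod>i<i. iter_ln i (iter_e k + s)) * 1) (at s)"
      using that by (intro DERIV_chain2[OF iter_ln_has_derivative[of k]])
        (auto intro!: derivative_eq_intros)
    then show "((\<lambda>s. iter_ln i (iter_e k + s)) has_real_derivative
        1 / (\<Prod>i<i. iter_ln i (iter_e k + s)) * 1) (at s within {0..t})"
      by (rule has_field_derivative_at_within)
  qed
  have ne: "iter_ln i (iter_e k + s) \<noteq> 0" if "s \<in> {0..t}" "i \<le> k" for s i
    using iter_ln_ge_1[of k "iter_e k + s" i] that by force
  show ?thesis
    unfolding damping_eq[abs_def]
    by (intro continuous_intros c) (auto simp: ne)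
qed

text \<open>Since k is arbitrary, the k-fold logarithm is bounded by a single one, which is possible
  as k \<ge> 1. Powers of one logarithm grow more slowly than any positive power of t.\<close>

lemma damping_weight_less_powr:
  assumes "k \<ge> 1" "\<mu> > 0" "\<theta> > 0" "D > 0"
  shows "\<exists>t\<ge>1. D * damping_weight \<mu> k t < t powr \<theta>"
proof -
  define a where "a = iter_e k"
  have a: "a \<ge> 1"
    using iter_e_ge_1 by (simp add: a_def)
  have "((\<lambda>t. ln (a + t) powr \<mu> / t powr \<theta>) \<longlongrightarrow> 0) at_top"
    using assms a by real_asymp
  then have "\<forall>\<^sub>F t in at_top. ln (a + t) powr \<mu> / t powr \<theta> < 1 / D"
    using assms by (intro order_tendstoD) auto
  then have "\<forall>\<^sub>F t in at_top. t \<ge> 1 \<and> ln (a + t) powr \<mu> / t powr \<theta> < 1 / D"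
    using eventually_ge_at_top by (rule eventually_conj[rotated])
  then obtain t where t: "t \<ge> 1" "ln (a + t) powr \<mu> / t powr \<theta> < 1 / D"
    using eventually_happens'[OF trivial_limit_at_top_linorder] by blast
  have "damping_weight \<mu> k t \<le> ln (a + t) powr \<mu>"
    unfolding damping_weight_def a_def
    using iter_ln_le_ln[of k "iter_e k + t" "k - 1"] iter_ln_ge_1[of k "iter_e k + t" k] assms t(1)
    by (intro powr_mono2) auto
  then have "D * damping_weight \<mu> k t \<le> D * ln (a + t) powr \<mu>"
    using assms by (intro mult_left_mono) auto
  also have "\<dots> < t powr \<theta>"
    using t assms by (simp add: field_simps)
  finally show ?thesis
    using t(1) by blast
qed

text \<open>Subcriticality is equivalent to (n - 1)(p - 1) < 2 for n \<ge> 2. The case n = 1 is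
  separate because \<open>p_Gla 1\<close> divides by zero; the exponent is then 1 / (p - 1).\<close>

lemma Glassey_exponent_pos:
  fixes p :: real
  assumes "p > 1" "n \<ge> 1" "n \<ge> 2 \<longrightarrow> p < p_Gla n"
  shows "1 / (p - 1) - (real n - 1) / 2 > 0"
proof (cases "n \<ge> 2")
  case True
  then have "p < (real n + 1) / (real n - 1)"
    using assms(3) by (simp add: p_Gla_def)
  then have "p * (real n - 1) < real n + 1"
    using True by (simp add: pos_less_divide_eq)
  then have "(real n - 1) * (p - 1) < 2"
    by (simp add: algebra_simps)
  then show ?thesis
    using assms(1) by (simp add: field_simps)
next
  case False
  then have "n = 1"
    using assms(2) by simp
  then show ?thesis
    using assms(1) by simp
qed

subsection \<open>The lifespan estimate\<close>

text \<open>Taking the power 1 / (p - 1) of the bound makes it linear in \<beta> / \<epsilon>. The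
  power t^\<kappa> that comes from the mass of the plane wave is then moved to the left, which
  lowers the exponent from 1 / (p - 1) to 1 / (p - 1) - \<kappa>.\<close>

lemma powr_time_bound:
  fixes p \<kappa> :: real
  assumes p: "p > 1" and R: "R > 0" and pos: "\<epsilon> > 0" "c > 0" "\<beta> > 0" and \<kappa>: "\<kappa> \<ge> 0" and t: "t \<ge> 1"
    and le: "(p - 1) / 2 * (2 * exp R * (4 * pi * (R + t)) powr \<kappa>) powr (1 - p)
    * t * \<beta> powr (1 - p) \<le> (\<epsilon> * c) powr (1 - p)"
  shows "t powr (1 / (p - 1) - \<kappa>) \<le>
    2 * exp R * (4 * pi * (R + 1)) powr \<kappa> * ((p - 1) / 2) powr (- 1 / (p - 1)) / c * \<beta> / \<epsilon>"
proof -
  define q where "q = p - 1"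
  have q: "q > 0" "1 - p = - q"
    using p by (auto simp: q_def)
  define E where "E = 2 * exp R * (4 * pi * (R + 1)) powr \<kappa>"
  define E' where "E' = 2 * exp R * (4 * pi * (R + t)) powr \<kappa>"
  have E: "E > 0" "E' > 0"
    using R t by (auto simp: E_def E'_def)
  \<comment> \<open>Here t \<ge> 1 enters: it allows R + t to be replaced by a pure multiple of
    t.\<close>
  have "R + t \<le> (R + 1) * t"
    using R t by (simp add: algebra_simps)
  then have "(4 * pi * (R + t)) powr \<kappa> \<le> (4 * pi * (R + 1) * t) powr \<kappa>"
    using R t \<kappa> by (intro powr_mono2) (auto simp: mult.assoc)
  also have "\<dots> = (4 * pi * (R + 1)) powr \<kappa> * t powr \<kappa>"
    by (rule powr_mult)
  finally have E'_le: "E' \<le> E * t powr \<kappa>"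
    by (simp add: E_def E'_def mult.assoc)
  have "q / 2 * E' powr - q * t * \<beta> powr - q \<le> (\<epsilon> * c) powr - q"
    using le unfolding q(2) E'_def[symmetric] by (simp add: q_def)
  then have "(q / 2 * E' powr - q * t * \<beta> powr - q) * (E' powr q * \<beta> powr q) \<le>
      (\<epsilon> * c) powr - q * (E' powr q * \<beta> powr q)"
    by (intro mult_right_mono) auto
  also have "(q / 2 * E' powr - q * t * \<beta> powr - q) * (E' powr q * \<beta> powr q) = q / 2 * t"
    using E(2) pos(3) by (simp add: powr_minus field_simps)
  also have "(\<epsilon> * c) powr - q * (E' powr q * \<beta> powr q) = (E' * \<beta> / (\<epsilon> * c)) powr q"
    using E(2) pos by (simp add: powr_minus powr_mult powr_divide field_simps)
  finally have "(q / 2 * t) powr (1 / q) \<le> ((E' * \<beta> / (\<epsilon> * c)) powr q) powr (1 / q)"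
    using q t by (intro powr_mono2) auto
  also have "\<dots> = E' * \<beta> / (\<epsilon> * c)"
    using q E pos by (simp add: powr_powr)
  also have "\<dots> \<le> E * t powr \<kappa> * \<beta> / (\<epsilon> * c)"
    using E'_le pos by (intro divide_right_mono mult_right_mono) auto
  finally have "(q / 2) powr (1 / q) * t powr (1 / q) \<le> E * t powr \<kappa> * \<beta> / (\<epsilon> * c)"
    by (simp only: powr_mult)
  then have "((q / 2) powr (1 / q) * t powr (1 / q)) * ((q / 2) powr (- 1 / q) * t powr - \<kappa>) \<le>
      E * t powr \<kappa> * \<beta> / (\<epsilon> * c) * ((q / 2) powr (- 1 / q) * t powr - \<kappa>)"
    by (intro mult_right_mono) auto
  also have "((q / 2) powr (1 / q) * t powr (1 / q)) * ((q / 2) powr (- 1 / q) * t powr - \<kappa>) =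
      ((q / 2) powr (1 / q) * (q / 2) powr (- 1 / q)) * (t powr (1 / q) * t powr - \<kappa>)"
    by (simp add: mult_ac)
  also have "\<dots> = t powr (1 / q - \<kappa>)"
    using q by (simp flip: powr_add)
  also have "E * t powr \<kappa> * \<beta> / (\<epsilon> * c) * ((q / 2) powr (- 1 / q) * t powr - \<kappa>) =
      E * (t powr \<kappa> * t powr - \<kappa>) * (q / 2) powr (- 1 / q) / c * \<beta> / \<epsilon>"
    by (simp add: mult_ac)
  also have "t powr \<kappa> * t powr - \<kappa> = 1"
    using t by (simp flip: powr_add)
  finally show ?thesis
    by (simp add: E_def q_def)
qed

text \<open>The bounded essential support makes the product with the exponential integrable. A
  nonnegative integrable function with integral 0 vanishes almost everywhere, and the exponential
  has no zeros, so a nontrivial f gives a strictly positive integral.\<close>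

lemma integral_mult_exp_nonneg:
  fixes f :: "real^'n \<Rightarrow> real" and i :: 'n
  assumes f: "L1_loc UNIV f" "AE x in lebesgue. 0 \<le> f x" and supp: "ess_support f \<subseteq> cball 0 R"
  shows "0 \<le> (LINT x|lebesgue. f x * exp (x $ i))"
    and "\<not> (AE x in lebesgue. f x = 0) \<Longrightarrow> 0 < (LINT x|lebesgue. f x * exp (x $ i))"
proof -
  have c: "continuous_on UNIV (\<lambda>x::real^'n. exp (x $ i))"
    by (intro continuous_intros)
  have "set_integrable lebesgue (cball 0 R) (\<lambda>x. f x * exp (x $ i))"
    using f(1) by (intro set_integrable_mult_continuous c) (auto simp: L1_loc_def)
  then have i0: "integrable lebesgue (\<lambda>x. indicator (cball 0 R) x * (f x * exp (x $ i)))"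
    by (simp add: set_integrable_def)
  have ae: "AE x in lebesgue. indicator (cball 0 R) x * (f x * exp (x $ i)) = f x * exp (x $ i)"
    using AE_zero_if_ess_support_subset[OF supp] by eventually_elim (auto simp: indicator_def)
  have meas: "(\<lambda>x. f x * exp (x $ i)) \<in> borel_measurable lebesgue"
    by (rule borel_measurable_completion_cong_AE[OF _ ae]) (use i0 in auto)
  have int: "integrable lebesgue (\<lambda>x. f x * exp (x $ i))"
    using i0 integrable_cong_AE[OF borel_measurable_integrable[OF i0] meas ae] by simp
  have nn: "AE x in lebesgue. 0 \<le> f x * exp (x $ i)"
    using f(2) by eventually_elim simp
  show ge: "0 \<le> (LINT x|lebesgue. f x * exp (x $ i))"
    by (rule integral_nonneg_AE[OF nn])
  show "0 < (LINT x|lebesgue. f x * exp (x $ i))" if "\<not> (AE x in lebesgue. f x = 0)"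
    using that ge integral_nonneg_eq_0_iff_AE[OF int nn] by auto
qed

text \<open>A time below the supremum lies inside the existence interval of some extension. That the
  extension agrees with u on the original interval is not recorded, since the time bound sees a
  solution only through its data.\<close>

lemma less_lifespanD:
  "x < lifespan b p \<epsilon> u0 u1 R T u \<Longrightarrow> \<exists>T' v. weak_solution b p \<epsilon> u0 u1 R T' v \<and> x < T'"
  unfolding lifespan_def less_Sup_iff by (elim bexE CollectE exE conjE) (intro exI conjI)

theorem theorem2p3:
  fixes \<mu> p R :: real and k :: nat and u0 u1 :: "real^'n \<Rightarrow> real"
  assumes "\<mu> > 0" and "k \<ge> 1"
    and "p > 1" and "CARD('n) \<ge> 2 \<longrightarrow> p < p_Gla CARD('n)"
    and "W11_loc u0" and "L1_loc UNIV u1"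
    and "AE x in lebesgue. u0 x \<ge> 0" and "AE x in lebesgue. u1 x \<ge> 0"
    and "\<not> (AE x in lebesgue. u0 x = 0)" and "\<not> (AE x in lebesgue. u1 x = 0)"
    and "compact (ess_support u0)" and "compact (ess_support u1)"
    and "R > 0" and "ess_support u0 \<union> ess_support u1 \<subseteq> cball 0 R"
  shows "(\<forall>\<epsilon>>0. \<forall>T u. weak_solution (damping \<mu> k) p \<epsilon> u0 u1 R T u \<longrightarrow>
            lifespan (damping \<mu> k) p \<epsilon> u0 u1 R T u < \<infinity>) \<and>
         (\<exists>\<epsilon>0>0. \<exists>C>0. \<forall>\<epsilon>. 0 < \<epsilon> \<and> \<epsilon> \<le> \<epsilon>0 \<longrightarrow>
            (\<forall>T u. weak_solution (damping \<mu> k) p \<epsilon> u0 u1 R T u \<longrightarrow>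
              (let T\<epsilon> = real_of_ereal (lifespan (damping \<mu> k) p \<epsilon> u0 u1 R T u);
                   \<theta> = 1 / (p - 1) - (real CARD('n) - 1) / 2
               in T\<epsilon> * iter_ln k (iter_e k + T\<epsilon>) powr (- \<mu> * inverse \<theta>)
                    \<le> C * \<epsilon> powr (- inverse \<theta>))))"
proof -
  note \<mu> = assms(1) and p = assms(3) and R = \<open>R > 0\<close>
  define \<theta> where "\<theta> = 1 / (p - 1) - (real CARD('n) - 1) / 2"
  have \<theta>: "\<theta> > 0"
    unfolding \<theta>_def using assms(3,4) by (intro Glassey_exponent_pos) (auto simp: Suc_leI)
  \<comment> \<open>Any coordinate direction will do for the plane wave.\<close>
  define i :: 'n where "i = undefined"
  have u0: "L1_loc UNIV u0"
    using assms(5) unfolding W11_loc_def weak_gradient_def by (elim exE conjE)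
  have supp: "ess_support u0 \<subseteq> cball 0 R" "ess_support u1 \<subseteq> cball 0 R"
    using assms(14) by auto
  define a0 where "a0 = (LINT x|lebesgue. u0 x * exp (x $ i))"
  define a1 where "a1 = (LINT x|lebesgue. u1 x * exp (x $ i))"
  have a: "a0 \<ge> 0" "a1 > 0"
    unfolding a0_def a1_def
    using integral_mult_exp_nonneg(1)[OF u0 assms(7) supp(1)]
      integral_mult_exp_nonneg(2)[OF assms(6) assms(8) supp(2) assms(10)] .
  \<comment> \<open>The largest constant with c \<le> a1 and 2 c \<le> a0 + a1, the two initial
    conditions of the damped system up to the factor \<epsilon>.\<close>
  define c where "c = min a1 ((a0 + a1) / 2)"
  have c: "c > 0" "c \<le> a1" "2 * c \<le> a0 + a1"
    using a by (auto simp: c_def min_def)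
  let ?\<beta> = "damping_weight \<mu> k"
  define \<kappa> where "\<kappa> = (real CARD('n) - 1) / 2"
  define D where "D = 2 * exp R * (4 * pi * (R + 1)) powr \<kappa> * ((p - 1) / 2) powr (- 1 / (p - 1)) / c"
  have D: "D > 0"
    using R c p by (simp add: D_def)
  have bound: "t powr \<theta> \<le> D * ?\<beta> t / \<epsilon>"
    if "\<epsilon> > 0" and t: "t \<ge> 1" "ereal t < lifespan (damping \<mu> k) p \<epsilon> u0 u1 R T u" for \<epsilon> t T u
  proof -
    obtain T' v where v: "weak_solution (damping \<mu> k) p \<epsilon> u0 u1 R T' v" "ereal t < T'"
      using less_lifespanD[OF t(2)] by (elim exE conjE) (rule that)
    have t0: "0 < t"
      using t(1) by simp
    have d\<beta>: "(?\<beta> has_real_derivative damping \<mu> k s * ?\<beta> s) (at s within {0..t})"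
      if "s \<in> {0..t}" for s
      using that by (simp add: damping_weight_has_derivative has_field_derivative_at_within)
    have \<beta>_pos: "0 < ?\<beta> s" if "s \<in> {0..t}" for s
      using damping_weight_ge_1[OF \<mu>, of s k] that by simp
    have b_nonneg: "0 \<le> damping \<mu> k s" if "s \<in> {0..t}" for s
      using damping_nonneg[OF \<mu>, of s k] that by simp
    have \<beta>_mono: "?\<beta> s \<le> ?\<beta> t" if "s \<in> {0..t}" for s
      using damping_weight_mono[OF \<mu>, of s t k] that by simp
    note time_bound = weak_solution_time_bound[where \<beta>="?\<beta>" and t=t and c=c and i=i,
        OF v(1) p \<open>\<epsilon> > 0\<close> R u0 assms(6) supp continuous_on_damping b_nonneg d\<beta> damping_weight_0
          \<beta>_pos \<beta>_mono t0 v(2), folded a0_def a1_def \<kappa>_def]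
    have "(p - 1) / 2 * (2 * exp R * (4 * pi * (R + t)) powr \<kappa>) powr (1 - p)
        * t * ?\<beta> t powr (1 - p) \<le> (\<epsilon> * c) powr (1 - p)"
      by (rule time_bound) (use c a(1) in simp_all)
    moreover have "?\<beta> t > 0"
      using damping_weight_ge_1[OF \<mu>, of t k] t(1) by linarith
    moreover have "\<kappa> \<ge> 0"
      by (simp add: \<kappa>_def Suc_leI)
    ultimately have "t powr (1 / (p - 1) - \<kappa>) \<le> 2 * exp R * (4 * pi * (R + 1)) powr \<kappa> *
        ((p - 1) / 2) powr (- 1 / (p - 1)) / c * ?\<beta> t / \<epsilon>"
      by (intro powr_time_bound[OF p R \<open>\<epsilon> > 0\<close> c(1) _ _ t(1)])
    then show ?thesis
      unfolding D_def \<theta>_def \<kappa>_def .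
  qed
  have finite: "lifespan (damping \<mu> k) p \<epsilon> u0 u1 R T u < \<infinity>" if \<epsilon>: "\<epsilon> > 0" for \<epsilon> T u
  proof (rule ccontr)
    assume "\<not> ?thesis"
    then have inf: "lifespan (damping \<mu> k) p \<epsilon> u0 u1 R T u = \<infinity>"
      by simp
    \<comment> \<open>Such a t contradicts \<open>bound\<close>, which an infinite lifespan would
      make valid at every t \<ge> 1.\<close>
    obtain t where t: "t \<ge> 1" "D / \<epsilon> * ?\<beta> t < t powr \<theta>"
      using damping_weight_less_powr[OF assms(2) \<mu> \<theta>, of "D / \<epsilon>"] D \<epsilon> by auto
    with bound[OF \<epsilon> t(1), of T u] inf show False
      by simp
  qed
  have estimate: "T\<epsilon> * iter_ln k (iter_e k + T\<epsilon>) powr (- \<mu> * inverse \<theta>)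
      \<le> max 1 (D powr (1 / \<theta>)) * \<epsilon> powr (- inverse \<theta>)"
    if \<epsilon>: "0 < \<epsilon>" "\<epsilon> \<le> 1" and sol: "weak_solution (damping \<mu> k) p \<epsilon> u0 u1 R T u"
      and T\<epsilon>: "T\<epsilon> = real_of_ereal (lifespan (damping \<mu> k) p \<epsilon> u0 u1 R T u)" for \<epsilon> T u T\<epsilon>
  proof -
    have "T \<le> lifespan (damping \<mu> k) p \<epsilon> u0 u1 R T u"
      unfolding lifespan_def by (rule Sup_upper) (use sol in auto)
    moreover have "0 < T"
      using sol by (simp add: weak_solution_def)
    ultimately have lpos: "0 < lifespan (damping \<mu> k) p \<epsilon> u0 u1 R T u"
      by (rule less_le_trans[rotated])
    \<comment> \<open>A positive finite lifespan is converted to a real number without loss; for an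
      infinite one \<open>real_of_ereal\<close> would return 0.\<close>
    then have life: "lifespan (damping \<mu> k) p \<epsilon> u0 u1 R T u = ereal T\<epsilon>"
      unfolding T\<epsilon> using finite[OF \<epsilon>(1), of T u]
      by (intro ereal_real'[symmetric]) auto
    have T\<epsilon>_pos: "T\<epsilon> > 0"
      using lpos unfolding life by simp
    define B where "B = ?\<beta> T\<epsilon>"
    have B: "B \<ge> 1"
      unfolding B_def using damping_weight_ge_1[OF \<mu>] T\<epsilon>_pos by simp
    have B_powr: "iter_ln k (iter_e k + T\<epsilon>) powr (- \<mu> * inverse \<theta>) = B powr (- inverse \<theta>)"
      by (simp add: B_def damping_weight_def powr_powr)
    have "T\<epsilon> * B powr (- inverse \<theta>) \<le> max 1 (D powr (1 / \<theta>)) * \<epsilon> powr (- inverse \<theta>)"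
    proof (cases "T\<epsilon> \<le> 1")
      \<comment> \<open>Lifespans below 1 are outside the reach of \<open>bound\<close>. They are
        absorbed by \<epsilon> \<le> 1, which is why \<epsilon>0 = 1 and why the constant is at
        least 1.\<close>
      case True
      have "B powr (- inverse \<theta>) \<le> 1"
        using B \<theta> powr_mono[of "- inverse \<theta>" 0 B] by simp
      then have "T\<epsilon> * B powr (- inverse \<theta>) \<le> 1 * 1"
        using True T\<epsilon>_pos by (intro mult_mono) auto
      also have "1 \<le> \<epsilon> powr (- inverse \<theta>)"
        using \<epsilon> \<theta> powr_mono'[of "- inverse \<theta>" 0 \<epsilon>] by simp
      then have "1 * 1 \<le> max 1 (D powr (1 / \<theta>)) * \<epsilon> powr (- inverse \<theta>)"
        by (intro mult_mono) auto
      finally show ?thesis .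
    next
      case False
      \<comment> \<open>The bound is available only strictly before the lifespan. Monotonicity of
        the weight replaces its value at t by the value B at the lifespan, so that the right-hand
        side no longer depends on t and t can be driven up to the lifespan.\<close>
      have le: "t \<le> (D * B / \<epsilon>) powr (1 / \<theta>)" if t: "1 < t" "t < T\<epsilon>" for t
      proof -
        have "t powr \<theta> \<le> D * ?\<beta> t / \<epsilon>"
          using t by (intro bound[OF \<epsilon>(1), of t T u]) (auto simp: life)
        also have "\<dots> \<le> D * B / \<epsilon>"
          unfolding B_def using t D \<epsilon>(1) \<mu>
          by (intro divide_right_mono mult_left_mono damping_weight_mono) auto
        finally have "(t powr \<theta>) powr (1 / \<theta>) \<le> (D * B / \<epsilon>) powr (1 / \<theta>)"
          using \<theta> by (intro powr_mono2) auto
        then show ?thesis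
          using t \<theta> by (simp add: powr_powr)
      qed
      have "T\<epsilon> \<le> (D * B / \<epsilon>) powr (1 / \<theta>)"
        by (rule dense_le_bounded[of 1]) (use False le in auto)
      also have "\<dots> = D powr (1 / \<theta>) * B powr (1 / \<theta>) * \<epsilon> powr (- inverse \<theta>)"
        using D B \<epsilon> by (simp add: powr_divide powr_mult powr_minus_divide inverse_eq_divide)
      finally have "T\<epsilon> * B powr (- inverse \<theta>) \<le>
          D powr (1 / \<theta>) * B powr (1 / \<theta>) * \<epsilon> powr (- inverse \<theta>) * B powr (- inverse \<theta>)"
        by (intro mult_right_mono) auto
      also have "\<dots> = D powr (1 / \<theta>) * \<epsilon> powr (- inverse \<theta>) * (B powr (1 / \<theta>) * B powr (- inverse \<theta>))"
        by (simp add: mult_ac)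
      also have "B powr (1 / \<theta>) * B powr (- inverse \<theta>) = 1"
        using B by (simp add: divide_inverse flip: powr_add)
      also have "D powr (1 / \<theta>) * \<epsilon> powr (- inverse \<theta>) * 1 \<le>
          max 1 (D powr (1 / \<theta>)) * \<epsilon> powr (- inverse \<theta>)"
        by (simp add: mult_right_mono)
      finally show ?thesis .
    qed
    then show ?thesis
      unfolding B_powr .
  qed
  show ?thesis
  proof (rule conjI, (intro allI impI)[1], erule finite, rule exI[of _ 1], rule conjI, rule zero_less_one,
      rule exI[of _ "max 1 (D powr (1 / \<theta>))"], intro conjI allI impI)
    fix \<epsilon> T u
    assume "0 < \<epsilon> \<and> \<epsilon> \<le> 1" "weak_solution (damping \<mu> k) p \<epsilon> u0 u1 R T u"
    then show "let T\<epsilon> = real_of_ereal (lifespan (damping \<mu> k) p \<epsilon> u0 u1 R T u);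
        \<theta>' = 1 / (p - 1) - (real CARD('n) - 1) / 2
      in T\<epsilon> * iter_ln k (iter_e k + T\<epsilon>) powr (- \<mu> * inverse \<theta>')
        \<le> max 1 (D powr (1 / \<theta>)) * \<epsilon> powr (- inverse \<theta>')"
      unfolding Let_def \<theta>_def[symmetric] by (intro estimate[OF _ _ _ refl]) auto
  qed simp
qed

end
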